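(* Let $m\ge 3$, $N_1\ge N_2\ge\cdots\ge N_m$ and $r\le r_m$, where $r_m$ is the integer defined in the context. Let $\mathbf u_2,\ldots,\mathbf u_m\in\mathbb{R}^r$ be vectors all of whose entries are nonzero. For $\tilde{\Theta}^*=(U_1^*,\tilde U_2^*,\ldots,\tilde U_m^* )$ with $U_1^*\in\mathbb{R}^{N_1\times r}$ and $\tilde U_i^*\in\mathbb{R}^{(N_i-1)\times r}$, $2\le i\le m$, let $$\mathcal{A}:=[\![U_1^*,[\mathbf u_2^T;\tilde U_2^*],\ldots,[\mathbf u_m^T;\tilde U_m^*]]\!],$$ and, for this $\mathcal A$, let $$\tilde f_A(\tilde\Theta):=\big\|\mathcal{A}-[\![U_1,[\mathbf u_2^T;\tilde U_2],\ldots,[\mathbf u_m^T;\tilde U_m]]\!]\big\|_F^2,\qquad \tilde\Theta=(U_1,\tilde U_2,\ldots,\tilde U_m),$$ with $U_1\in\mathbb{R}^{N_1\times r}$, $\tilde U_i\in\mathbb{R}^{(N_i-1)\times r}$. Then, for generic $\tilde\Theta^*$, the Hessian $\nabla^2\tilde f_A(\tilde\Theta^* )$ is positive definite, and there exist an open set $O$ containing $\tilde\Theta^*$ and a constant $\lambda>0$ such that $\tilde f_A$ is $\lambda$-strongly convex in $O$.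
   Context: For matrices $U_i\in\mathbb{R}^{N_i\times r}$, $[\![U_1,\ldots,U_m]\!]:=\sum_{j=1}^r U_1(:,j)\circ\cdots\circ U_m(:,j)$ is the order-$m$ tensor whose $(i_1,\ldots,i_m)$ entry is $\sum_{j=1}^r\prod_{k=1}^m U_k(i_k,j)$. $\|\cdot\|_F$ is the square root of the sum of squared entries. $[\mathbf u_i^T;\tilde U_i]\in\mathbb{R}^{N_i\times r}$ is the matrix whose first row is $\mathbf u_i^T$ and whose remaining rows are those of $\tilde U_i$. The tuple $\tilde\Theta$ is regarded as a vector of $r(N_1+\sum_{i=2}^m(N_i-1))$ real variables, and $\nabla^2$ is the Hessian with respect to these variables. A property is generic if it holds on the whole parameter space except on a subset of (Lebesgue) measure zero. A twice-differentiable function is $\lambda$-strongly convex in an open set $O$ (with $\lambda>0$) if the smallest eigenvalue of its Hessian is not less than $\lambda$ at every point of $O$. Definition of $r_m$ (for $m\ge3$, $N_1\ge\cdots\ge N_m$): let $\tilde N_{m-2},\tilde N_{m-1},\tilde N_m$ be the largest integers such that (i) $\tilde N_{m-2}$ is even, (ii) $\tilde N_{m-2}\ge\tilde N_{m-1}\ge\tilde N_m$, and (iii) $N_i\ge\tilde N_i$ for $i=m-2,m-1,m$. Set $$r_3:=\tilde N_{m-2}\left\lfloor\frac{\tilde N_{m-1}\tilde N_m}{\tilde N_{m-2}+\tilde N_{m-1}+\tilde N_m-2}\right\rfloor,$$ and recursively, for $k=4,\ldots,m$, $$r_k:=N_{m-k+1}\min\left\{r_{k-1},\left\lfloor\frac{N_{m-k+2}\cdots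 N_m}{N_{m-k+1}+\cdots+N_m-k+1}\right\rfloor\right\}.$$ *)

theory Defs
  imports "HOL-Analysis.Analysis"
begin

section \<open>The rank bound\<close>

text \<open>
  The order on triples is the componentwise one, so \<open>Greatest\<close> is the simultaneous
  maximum of all three entries; it exists by the lemma below.
\<close>

definition trimmed_sizes :: "nat \<Rightarrow> nat \<Rightarrow> nat \<Rightarrow> nat \<times> nat \<times> nat" where
  "trimmed_sizes p q s =
     Greatest (\<lambda>(a, b, c). even a \<and> b \<le> a \<and> c \<le> b \<and> a \<le> p \<and> b \<le> q \<and> c \<le> s)"

lemma trimmed_sizes_eq:
  "trimmed_sizes p q s =
     (let a = 2 * (p div 2); b = min q a; c = min s b in (a, b, c))"
  unfolding trimmed_sizes_def Let_def
  by (rule Greatest_equality; clarsimp simp: less_eq_prod_def; presburger)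

text \<open>
  \<open>rank_bound m N k\<close> is the number \<open>r\<^sub>k\<close> for \<open>3 \<le> k \<le> m\<close> (the value for \<open>k < 3\<close> is
  irrelevant). When all \<open>N i\<close> are positive, the truncated subtraction matters only in \<open>r\<^sub>3\<close>
  with all trimmed sizes 0; then \<open>r\<^sub>3 = 0\<close> because of the leading factor.
\<close>

fun rank_bound :: "nat \<Rightarrow> (nat \<Rightarrow> nat) \<Rightarrow> nat \<Rightarrow> nat" where
  "rank_bound m N k =
     (if k \<le> 3 then
        (case trimmed_sizes (N (m - 2)) (N (m - 1)) (N m) of
           (a, b, c) \<Rightarrow> a * (b * c div (a + b + c - 2)))
      else
        N (m - k + 1) *
          min (rank_bound m N (k - 1))
              ((\<Prod>i\<in>{m - k + 2..m}. N i) div ((\<Sum>i\<in>{m - k + 1..m}. N i) - k + 1)))"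

declare rank_bound.simps [simp del]


section \<open>Tensors in factored form\<close>

text \<open>
  Modes, rows and columns are numbered from 1. A matrix is a function of row and column,
  an order-\<open>m\<close> tensor a function of a multi-index \<open>\<iota>\<close>; only arguments within the
  sizes \<open>N\<close> and \<open>r\<close> matter.
\<close>

definition cp_tensor ::
    "nat \<Rightarrow> nat \<Rightarrow> (nat \<Rightarrow> nat \<Rightarrow> nat \<Rightarrow> real) \<Rightarrow> (nat \<Rightarrow> nat) \<Rightarrow> real" where
  "cp_tensor m r U \<iota> = (\<Sum>j\<in>{1..r}. \<Prod>k\<in>{1..m}. U k (\<iota> k) j)"

definition frobenius_norm :: "nat \<Rightarrow> (nat \<Rightarrow> nat) \<Rightarrow> ((nat \<Rightarrow> nat) \<Rightarrow> real) \<Rightarrow> real" where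
  "frobenius_norm m N T = sqrt (\<Sum>\<iota>\<in>PiE {1..m} (\<lambda>k. {1..N k}). (T \<iota>)\<^sup>2)"

definition prepend_row ::
    "(nat \<Rightarrow> real) \<Rightarrow> (nat \<Rightarrow> nat \<Rightarrow> real) \<Rightarrow> nat \<Rightarrow> nat \<Rightarrow> real" where
  "prepend_row v M a j = (if a = 1 then v j else M (a - 1) j)"

text \<open>
  The triple \<open>(i, a, j)\<close> names the real variable in row \<open>a\<close> and column \<open>j\<close> of the \<open>i\<close>-th
  component of \<open>(U\<^sub>1, U'\<^sub>2, \<dots>, U'\<^sub>m)\<close>, where \<open>U'\<^sub>i\<close> for \<open>i \<ge> 2\<close> is the \<open>i\<close>-th factor without
  its first row. An enumeration \<open>e\<close>, bijective from these triples to a finite type \<open>'d\<close>,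
  makes such a tuple a vector in \<open>real ^ 'd\<close>.
\<close>

definition param_index :: "nat \<Rightarrow> (nat \<Rightarrow> nat) \<Rightarrow> nat \<Rightarrow> (nat \<times> nat \<times> nat) set" where
  "param_index m N r =
     (SIGMA i:{1..m}. {1..(if i = 1 then N i else N i - 1)} \<times> {1..r})"

lemma card_param_index:
  assumes "m \<ge> 1"
  shows "card (param_index m N r) = r * (N 1 + (\<Sum>i\<in>{2..m}. N i - 1))"
proof -
  have "{1..m} = insert 1 {2..m}" using assms by auto
  then show ?thesis
    by (simp add: param_index_def card_SigmaI algebra_simps sum_distrib_left)
qed

definition factors ::
    "(nat \<times> nat \<times> nat \<Rightarrow> 'd) \<Rightarrow> (nat \<Rightarrow> nat \<Rightarrow> real) \<Rightarrow> real ^ 'd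
      \<Rightarrow> nat \<Rightarrow> nat \<Rightarrow> nat \<Rightarrow> real" where
  "factors e u \<theta> i =
     (let M = (\<lambda>a j. \<theta> $ e (i, a, j)) in if i = 1 then M else prepend_row (u i) M)"

definition cost ::
    "nat \<Rightarrow> (nat \<Rightarrow> nat) \<Rightarrow> nat \<Rightarrow> (nat \<times> nat \<times> nat \<Rightarrow> 'd) \<Rightarrow> (nat \<Rightarrow> nat \<Rightarrow> real)
      \<Rightarrow> ((nat \<Rightarrow> nat) \<Rightarrow> real) \<Rightarrow> real ^ 'd \<Rightarrow> real" where
  "cost m N r e u A \<theta> =
     (frobenius_norm m N (\<lambda>\<iota>. A \<iota> - cp_tensor m r (factors e u \<theta>) \<iota>))\<^sup>2"


section \<open>Hessians and strong convexity\<close>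

definition gradient :: "(real ^ 'd \<Rightarrow> real) \<Rightarrow> real ^ 'd \<Rightarrow> real ^ 'd" where
  "gradient f x = (\<chi> p. frechet_derivative f (at x) (axis p 1))"

definition hessian :: "(real ^ 'd \<Rightarrow> real) \<Rightarrow> real ^ 'd \<Rightarrow> real ^ 'd ^ 'd" where
  "hessian f x = jacobian (gradient f) (at x)"

definition twice_differentiable_on ::
    "(real ^ 'd \<Rightarrow> real) \<Rightarrow> (real ^ 'd) set \<Rightarrow> bool" where
  "twice_differentiable_on f S \<longleftrightarrow>
     (\<forall>x\<in>S. f differentiable (at x) \<and> gradient f differentiable (at x))"

definition positive_definite :: "real ^ 'd ^ 'd \<Rightarrow> bool" where
  "positive_definite A \<longleftrightarrow> transpose A = A \<and> (\<forall>x. x \<noteq> 0 \<longrightarrow> x \<bullet> (A *v x) > 0)"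

definition smallest_eigenvalue :: "real ^ 'd ^ 'd \<Rightarrow> real" where
  "smallest_eigenvalue A = (LEAST \<mu>. \<exists>v. v \<noteq> 0 \<and> A *v v = \<mu> *\<^sub>R v)"

definition strongly_convex_in ::
    "real \<Rightarrow> (real ^ 'd \<Rightarrow> real) \<Rightarrow> (real ^ 'd) set \<Rightarrow> bool" where
  "strongly_convex_in c f S \<longleftrightarrow>
     twice_differentiable_on f S \<and> (\<forall>x\<in>S. smallest_eigenvalue (hessian f x) \<ge> c)"

end

theory Submission
  imports Defs "HOL-Computational_Algebra.Polynomial"
begin

text \<open>
  Where the residual vanishes, the Hessian of the cost is twice the Gram matrix of the Jacobian of
  the parametrization, so everything reduces to injectivity of that Jacobian at one point:
  the bad set is the zero set of a polynomial, hence null.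

  Injectivity at one point is nondefectivity of the Segre variety: \<open>r\<close> tangent spaces at suitable
  rank-one tensors are independent. Distribute the first-mode vectors over the coordinate axes,
  \<open>q\<close> points per axis. The tangent spaces then split along the slices; a slice sees the tangent
  spaces of its own \<open>q\<close> points in the remaining modes and just the rank-one tensors of all the
  others, which are general and therefore independent of them as long as the dimensions permit.
  For three modes one axis per block fails, since secant varieties of matrices are defective.
  There the blocks are coordinate planes carrying \<open>2 q\<close> points with first-mode vectors \<open>(1, s)\<close>,
  and the matrix pencils are handled by explicit unit vectors and sums of paired unit vectors;
  this pairing is why the first size has to be even.
\<close>

section \<open>Independent families and generic points\<close>

text \<open>Genericity is tested on lines only. Independence of a family with entries polynomial in
  a line parameter fails at finitely many points of a line through one good point. Hence finitely
  many such conditions, each satisfiable alone, hold at a common point, and Fubini along rays turns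
  the same fact into a null set; no polynomial in several variables has to be handled.

  The divisors of the rank bounds are counts per unit of \<open>q\<close>. A slice contains
  \<open>1 + (\<Sum>k\<in>K. N k - 1)\<close> vectors from each of its q points and one from each of
  the \<open>(N l - 1) * q\<close> others. In a block of two slices, with first size a and last
  sizes b, c, the 2 q own points bring b + c vectors each and the (a - 2) q others two each, against
  2 b c coordinates; hence a + b + c - 2.

  The parametrization by full factors is not an immersion, since rescaling the factors of one term
  by scalars of product 1 leaves the tensor unchanged. Prescribing nonzero first rows in all modes
  but the first removes exactly this freedom.\<close>

definition polyfun :: "(real \<Rightarrow> real) \<Rightarrow> bool" where
  "polyfun f \<longleftrightarrow> (\<exists>p. \<forall>t. f t = poly p t)"

lemma polyfun_const [simp]: "polyfun (\<lambda>t. c)"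
  unfolding polyfun_def by (rule exI[of _ "[:c:]"]) simp

lemma polyfun_ident [simp]: "polyfun (\<lambda>t. t)"
  unfolding polyfun_def by (rule exI[of _ "[:0, 1:]"]) simp

lemma polyfun_add [intro]: "polyfun f \<Longrightarrow> polyfun g \<Longrightarrow> polyfun (\<lambda>t. f t + g t)"
  unfolding polyfun_def by (metis poly_add)

lemma polyfun_diff [intro]: "polyfun f \<Longrightarrow> polyfun g \<Longrightarrow> polyfun (\<lambda>t. f t - g t)"
  unfolding polyfun_def by (metis poly_diff)

lemma polyfun_mult [intro]: "polyfun f \<Longrightarrow> polyfun g \<Longrightarrow> polyfun (\<lambda>t. f t * g t)"
  unfolding polyfun_def by (metis poly_mult)

lemma polyfun_sum [intro]: "(\<And>a. a \<in> A \<Longrightarrow> polyfun (f a)) \<Longrightarrow> polyfun (\<lambda>t. \<Sum>a\<in>A. f a t)"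
  by (induction A rule: infinite_finite_induct) auto

lemma polyfun_prod [intro]: "(\<And>a. a \<in> A \<Longrightarrow> polyfun (f a)) \<Longrightarrow> polyfun (\<lambda>t. \<Prod>a\<in>A. f a t)"
  by (induction A rule: infinite_finite_induct) auto

lemma polyfun_finite_zeros:
  assumes "polyfun f" "f t0 \<noteq> 0"
  shows "finite {t. f t = 0}"
proof -
  obtain p where p: "\<And>t. f t = poly p t" using assms(1) by (auto simp: polyfun_def)
  then have "p \<noteq> 0" using assms(2) by auto
  then show ?thesis using poly_roots_finite p by simp
qed

text \<open>A family, not a set: two equal members are dependent. The coordinate set
  \<open>I\<close> is explicit because the arguments keep restricting a relation to a slice or to
  selected positions.\<close>

definition indep_on :: "'i set \<Rightarrow> 'j set \<Rightarrow> ('j \<Rightarrow> 'i \<Rightarrow> real) \<Rightarrow> bool" where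
  "indep_on I J v \<longleftrightarrow>
     (\<forall>c. (\<forall>\<iota>\<in>I. (\<Sum>j\<in>J. c j * v j \<iota>) = 0) \<longrightarrow> (\<forall>j\<in>J. c j = 0))"

lemma indep_onI:
  "(\<And>c j. (\<And>\<iota>. \<iota> \<in> I \<Longrightarrow> (\<Sum>j\<in>J. c j * v j \<iota>) = 0) \<Longrightarrow> j \<in> J \<Longrightarrow> c j = 0) \<Longrightarrow> indep_on I J v"
  unfolding indep_on_def by blast

lemma indep_onD:
  "indep_on I J v \<Longrightarrow> (\<And>\<iota>. \<iota> \<in> I \<Longrightarrow> (\<Sum>j\<in>J. c j * v j \<iota>) = 0) \<Longrightarrow> j \<in> J \<Longrightarrow> c j = 0"
  unfolding indep_on_def by blast

lemma indep_on_subset: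
  assumes "indep_on I J v" "J' \<subseteq> J" "finite J"
  shows "indep_on I J' v"
proof (rule indep_onI)
  fix c j assume c: "\<And>\<iota>. \<iota> \<in> I \<Longrightarrow> (\<Sum>j\<in>J'. c j * v j \<iota>) = 0" and j: "j \<in> J'"
  have "(\<Sum>j\<in>J. (if j \<in> J' then c j else 0) * v j \<iota>) = 0" if "\<iota> \<in> I" for \<iota>
  proof -
    have "(\<Sum>j\<in>J. (if j \<in> J' then c j else 0) * v j \<iota>) = (\<Sum>j\<in>J'. c j * v j \<iota>)"
      using assms by (intro sum.mono_neutral_cong_right) auto
    then show ?thesis using c that by simp
  qed
  from indep_onD[OF assms(1) this, of j] show "c j = 0" using j assms by auto
qed

lemma indep_on_mono: "indep_on I J v \<Longrightarrow> I \<subseteq> I' \<Longrightarrow> indep_on I' J v"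
  unfolding indep_on_def by blast

lemma indep_on_empty [simp]: "indep_on I {} v"
  by (simp add: indep_on_def)

text \<open>On the coordinates \<open>I' g\<close> every member outside \<open>S g\<close> vanishes,
  so a relation restricts there to a relation of \<open>S g\<close> alone.\<close>

lemma indep_on_slices:
  assumes "\<And>j. j \<in> J \<Longrightarrow> \<exists>g\<in>G. j \<in> S g" "\<And>g. g \<in> G \<Longrightarrow> S g \<subseteq> J" "finite J"
    and "\<And>g. g \<in> G \<Longrightarrow> I' g \<subseteq> I"
    and "\<And>g j \<iota>. g \<in> G \<Longrightarrow> \<iota> \<in> I' g \<Longrightarrow> j \<in> J \<Longrightarrow> j \<notin> S g \<Longrightarrow> v j \<iota> = 0"
    and "\<And>g. g \<in> G \<Longrightarrow> indep_on (I' g) (S g) v"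
  shows "indep_on I J v"
proof (rule indep_onI)
  fix c j assume c: "\<And>\<iota>. \<iota> \<in> I \<Longrightarrow> (\<Sum>j\<in>J. c j * v j \<iota>) = 0" and j: "j \<in> J"
  obtain g where g: "g \<in> G" "j \<in> S g" using assms(1) j by blast
  have "(\<Sum>j\<in>S g. c j * v j \<iota>) = 0" if "\<iota> \<in> I' g" for \<iota>
  proof -
    have "(\<Sum>j\<in>S g. c j * v j \<iota>) = (\<Sum>j\<in>J. c j * v j \<iota>)"
      using assms g that by (intro sum.mono_neutral_left) auto
    then show ?thesis using c assms(4) g that by auto
  qed
  from indep_onD[OF assms(6)[OF g(1)] this g(2)] show "c j = 0" .
qed

text \<open>Each coordinate of \<open>w\<close> is matched by some coordinate of \<open>v\<close>,
  so a relation of \<open>v\<close> becomes a relation of \<open>w\<close> under the relabelling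
  \<open>f\<close>.\<close>

lemma indep_on_transfer:
  assumes "indep_on I' J' w" "bij_betw f J J'"
    and "\<And>\<iota>'. \<iota>' \<in> I' \<Longrightarrow> \<exists>\<iota>\<in>I. \<forall>j\<in>J. v j \<iota> = w (f j) \<iota>'"
  shows "indep_on I J v"
proof (rule indep_onI)
  fix c j assume c: "\<And>\<iota>. \<iota> \<in> I \<Longrightarrow> (\<Sum>j\<in>J. c j * v j \<iota>) = 0" and j: "j \<in> J"
  let ?g = "inv_into J f"
  have "(\<Sum>j\<in>J'. c (?g j) * w j \<iota>') = 0" if \<iota>': "\<iota>' \<in> I'" for \<iota>'
  proof -
    obtain \<iota> where \<iota>: "\<iota> \<in> I" "\<And>j. j \<in> J \<Longrightarrow> v j \<iota> = w (f j) \<iota>'"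
      using assms(3)[OF \<iota>'] by blast
    have "(\<Sum>j\<in>J'. c (?g j) * w j \<iota>') = (\<Sum>j\<in>J. c (?g (f j)) * w (f j) \<iota>')"
      by (rule sum.reindex_bij_betw[OF assms(2), symmetric])
    also have "\<dots> = (\<Sum>j\<in>J. c j * v j \<iota>)"
      using assms(2) \<iota>(2) by (intro sum.cong) (auto simp: bij_betw_def)
    finally show ?thesis using c \<iota>(1) by simp
  qed
  from indep_onD[OF assms(1) this, of "f j"] have "c (?g (f j)) = 0"
    using j assms(2) by (auto simp: bij_betw_def)
  then show "c j = 0" using j assms(2) by (auto simp: bij_betw_def)
qed

text \<open>Elimination without division, so that coordinates polynomial along a line stay polynomial.\<close>

lemma indep_on_eliminate:
  assumes "finite J" "n \<notin> J" "\<kappa> \<in> I" "v n \<kappa> \<noteq> 0"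
  shows "indep_on I (insert n J) v \<longleftrightarrow>
    indep_on I J (\<lambda>j \<iota>. v n \<kappa> * v j \<iota> - v j \<kappa> * v n \<iota>)" (is "_ \<longleftrightarrow> indep_on I J ?w")
proof
  assume *: "indep_on I (insert n J) v"
  show "indep_on I J ?w"
  proof (rule indep_onI)
    fix c j assume c: "\<And>\<iota>. \<iota> \<in> I \<Longrightarrow> (\<Sum>j\<in>J. c j * ?w j \<iota>) = 0" and j: "j \<in> J"
    define d where "d i = (if i = n then - (\<Sum>j\<in>J. c j * v j \<kappa>) else c i * v n \<kappa>)" for i
    have "(\<Sum>j\<in>insert n J. d j * v j \<iota>) = (\<Sum>j\<in>J. c j * ?w j \<iota>)" for \<iota>
    proof -
      have "(\<Sum>j\<in>J. d j * v j \<iota>) = (\<Sum>j\<in>J. c j * v n \<kappa> * v j \<iota>)"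
        using assms by (intro sum.cong) (auto simp: d_def)
      then show ?thesis using assms
        by (simp add: d_def[of n] algebra_simps sum_subtractf sum_distrib_left sum_distrib_right)
    qed
    then have "d j = 0" using indep_onD[OF *, of d j] c j by simp
    then show "c j = 0" using assms j by (auto simp: d_def split: if_splits)
  qed
next
  assume *: "indep_on I J ?w"
  show "indep_on I (insert n J) v"
  proof (rule indep_onI)
    fix c j assume c: "\<And>\<iota>. \<iota> \<in> I \<Longrightarrow> (\<Sum>j\<in>insert n J. c j * v j \<iota>) = 0" and j: "j \<in> insert n J"
    have c': "(\<Sum>j\<in>J. c j * v j \<iota>) = - c n * v n \<iota>" if "\<iota> \<in> I" for \<iota>
      using c[OF that] assms by simp
    have "(\<Sum>j\<in>J. c j * ?w j \<iota>) = v n \<kappa> * (\<Sum>j\<in>J. c j * v j \<iota>) - (\<Sum>j\<in>J. c j * v j \<kappa>) * v n \<iota>" for \<iota>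
      by (simp add: algebra_simps sum_subtractf sum_distrib_left sum_distrib_right)
    then have "(\<Sum>j\<in>J. c j * ?w j \<iota>) = 0" if "\<iota> \<in> I" for \<iota>
      using that assms(3) by (simp add: c')
    then have cJ: "c j = 0" if "j \<in> J" for j using indep_onD[OF * _ that] by blast
    then have "c n = 0" using c'[OF assms(3)] assms(4) by simp
    then show "c j = 0" using cJ j by auto
  qed
qed

lemma indep_on_insert_pivot:
  assumes "indep_on I (insert n J) v" "finite J" "n \<notin> J"
  shows "\<exists>\<kappa>\<in>I. v n \<kappa> \<noteq> 0"
proof (rule ccontr)
  assume "\<not> ?thesis"
  then have "(\<Sum>j\<in>insert n J. of_bool (j = n) * v j \<iota>) = 0" if "\<iota> \<in> I" for \<iota>
    using that by (intro sum.neutral) auto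
  from indep_onD[OF assms(1) this, of n] show False by simp
qed

text \<open>Fraction-free elimination replaces minors: the pivot entry is a polynomial in t that is
  nonzero at \<open>t0\<close>, so away from its finitely many zeros the question passes to the
  eliminated family, which is shorter by one and again polynomial.\<close>

lemma indep_on_generic:
  assumes "finite J" "\<And>j \<iota>. j \<in> J \<Longrightarrow> \<iota> \<in> I \<Longrightarrow> polyfun (\<lambda>t. v t j \<iota>)" "indep_on I J (v t0)"
  shows "finite {t. \<not> indep_on I J (v t)}"
  using assms
proof (induction J arbitrary: v rule: finite_induct)
  case empty
  then show ?case by simp
next
  case (insert n J)
  obtain \<kappa> where \<kappa>: "\<kappa> \<in> I" "v t0 n \<kappa> \<noteq> 0"
    using indep_on_insert_pivot[OF insert.prems(2) insert.hyps] by blast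
  define w where "w t j \<iota> = v t n \<kappa> * v t j \<iota> - v t j \<kappa> * v t n \<iota>" for t j \<iota>
  have elim: "indep_on I (insert n J) (v t) \<longleftrightarrow> indep_on I J (w t)" if "v t n \<kappa> \<noteq> 0" for t
    unfolding w_def by (rule indep_on_eliminate[where v = "v t", OF insert.hyps \<kappa>(1) that])
  have "finite {t. \<not> indep_on I J (w t)}"
    proof (rule insert.IH)
    show "polyfun (\<lambda>t. w t j \<iota>)" if "j \<in> J" "\<iota> \<in> I" for j \<iota>
      unfolding w_def using \<kappa>(1) that
      by (intro polyfun_diff polyfun_mult insert.prems(1)) simp_all
    show "indep_on I J (w t0)"
      using elim[OF \<kappa>(2)] insert.prems(2) by simp
  qed
  moreover have "finite {t. v t n \<kappa> = 0}"
    using insert.prems(1)[of n \<kappa>] \<kappa> by (intro polyfun_finite_zeros) auto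
  ultimately have "finite ({t. \<not> indep_on I J (w t)} \<union> {t. v t n \<kappa> = 0})" by blast
  then show ?case by (rule finite_subset[rotated]) (use elim in auto)
qed

text \<open>Row rank equals column rank, by elimination: once position \<kappa> is cleared all
  remaining members vanish there, so the positions found later differ from \<kappa>.\<close>

lemma indep_on_pivots:
  assumes "finite J" "indep_on I J v"
  shows "\<exists>I0\<subseteq>I. finite I0 \<and> card I0 = card J \<and> indep_on I0 J v"
  using assms
proof (induction J arbitrary: v I rule: finite_induct)
  case empty
  then show ?case by (intro exI[of _ "{}"]) auto
next
  case (insert n J)
  obtain \<kappa> where \<kappa>: "\<kappa> \<in> I" "v n \<kappa> \<noteq> 0"
    using indep_on_insert_pivot[OF insert.prems insert.hyps] by blast
  define w where "w j \<iota> = v n \<kappa> * v j \<iota> - v j \<kappa> * v n \<iota>" for j \<iota>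
  have w\<kappa>: "w j \<kappa> = 0" for j by (simp add: w_def)
  have elim: "indep_on I' (insert n J) v \<longleftrightarrow> indep_on I' J w" if "\<kappa> \<in> I'" for I'
    unfolding w_def by (rule indep_on_eliminate[where v = v, OF insert.hyps that \<kappa>(2)])
  have "indep_on (I - {\<kappa>}) J w"
  proof (rule indep_onI)
    fix c j assume c: "\<And>\<iota>. \<iota> \<in> I - {\<kappa>} \<Longrightarrow> (\<Sum>j\<in>J. c j * w j \<iota>) = 0" and j: "j \<in> J"
    have "(\<Sum>j\<in>J. c j * w j \<iota>) = 0" if "\<iota> \<in> I" for \<iota>
      using that c by (cases "\<iota> = \<kappa>") (simp_all add: w\<kappa>)
    then show "c j = 0" using indep_onD[of I J w c j] elim[OF \<kappa>(1)] insert.prems j by blast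
  qed
  from insert.IH[OF this] obtain I0 where I0: "I0 \<subseteq> I - {\<kappa>}" "finite I0" "card I0 = card J" "indep_on I0 J w"
    by blast
  have "indep_on (insert \<kappa> I0) (insert n J) v"
    using elim[of "insert \<kappa> I0"] indep_on_mono[OF I0(4)] by blast
  moreover have "\<kappa> \<notin> I0" using I0 by blast
  ultimately show ?case using I0 \<kappa> insert.hyps
    by (intro exI[of _ "insert \<kappa> I0"]) auto
qed

text \<open>A substitute for Zariski openness that needs no topology on the infinitely many
  coordinates. An unsatisfiable condition counts as generic, hence satisfiability is asked for
  separately below.\<close>

definition generic :: "(('b \<Rightarrow> real) \<Rightarrow> bool) \<Rightarrow> bool" where
  "generic C \<longleftrightarrow> (\<forall>x y. C x \<longrightarrow> finite {t. \<not> C (\<lambda>b. (1 - t) * x b + t * y b)})"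

text \<open>The line joining a point good for the earlier conditions to one good for the new
  condition loses finitely many parameters to each of them.\<close>

lemma generic_common_point:
  assumes "finite G" "\<And>g. g \<in> G \<Longrightarrow> generic (C g)" "\<And>g. g \<in> G \<Longrightarrow> \<exists>x. C g x"
  shows "\<exists>x. \<forall>g\<in>G. C g x"
  using assms
proof (induction G rule: finite_induct)
  case empty
  then show ?case by simp
next
  case (insert g G)
  obtain x where x: "\<forall>g\<in>G. C g x" using insert by auto
  obtain y where y: "C g y" using insert.prems(2)[of g] by blast
  let ?l = "\<lambda>t b. (1 - t) * x b + t * y b"
  have "finite (\<Union>h\<in>G. {t. \<not> C h (?l t)})"
    using insert x by (auto simp: generic_def)
  \<comment> \<open>\<open>generic\<close> bounds the failures on lines leaving a good point. Here
    the good point sits at t = 1, so the line is traversed backwards.\<close>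
  moreover have "finite {t. \<not> C g (?l t)}"
  proof -
    have "finite {t. \<not> C g (\<lambda>b. (1 - t) * y b + t * x b)}"
      using insert y by (auto simp: generic_def)
    then have "finite ((\<lambda>t. 1 - t) ` {t. \<not> C g (\<lambda>b. (1 - t) * y b + t * x b)})" by blast
    then show ?thesis
    proof (rule finite_subset[rotated], intro subsetI)
      fix t assume "t \<in> {t. \<not> C g (?l t)}"
      then have "\<not> C g (\<lambda>b. (1 - (1 - t)) * y b + (1 - t) * x b)" by (simp add: add.commute)
      then show "t \<in> (\<lambda>t. 1 - t) ` {t. \<not> C g (\<lambda>b. (1 - t) * y b + t * x b)}"
        by (intro image_eqI[of _ _ "1 - t"]) auto
    qed
  qed
  ultimately have "finite ((\<Union>h\<in>G. {t. \<not> C h (?l t)}) \<union> {t. \<not> C g (?l t)})" by blast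
  from ex_new_if_finite[OF infinite_UNIV_char_0 this] obtain t where
    "t \<notin> (\<Union>h\<in>G. {t. \<not> C h (?l t)}) \<union> {t. \<not> C g (?l t)}" by blast
  then show ?case by (intro exI[of _ "?l t"]) auto
qed

section \<open>Tangent spaces of the Segre variety\<close>

definition multi_indices :: "nat set \<Rightarrow> (nat \<Rightarrow> nat) \<Rightarrow> (nat \<Rightarrow> nat) set" where
  "multi_indices K N = PiE K (\<lambda>k. {1..N k})"

text \<open>\<open>Some (k, i)\<close> stands for the partial derivative of the rank-one tensor with
  respect to the entry \<open>X k i\<close>.\<close>

fun tangent :: "nat set \<Rightarrow> (nat \<Rightarrow> nat \<Rightarrow> real) \<Rightarrow> (nat \<times> nat) option \<Rightarrow> (nat \<Rightarrow> nat) \<Rightarrow> real" where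
  "tangent K X None \<iota> = (\<Prod>k\<in>K. X k (\<iota> k))"
| "tangent K X (Some (k, i)) \<iota> = of_bool (\<iota> k = i) * (\<Prod>k'\<in>K - {k}. X k' (\<iota> k'))"

text \<open>
  The tangent space of the Segre cone at a rank-one tensor has the basis consisting of the tensor
  itself (direction \<open>None\<close>) and the directions \<open>(k, i)\<close> for \<open>i \<noteq> i0 k\<close>; it is one as soon as the
  factors have nonzero entries at the rows \<open>i0 k\<close>.
\<close>

definition dirs :: "nat set \<Rightarrow> (nat \<Rightarrow> nat) \<Rightarrow> (nat \<Rightarrow> nat) \<Rightarrow> (nat \<times> nat) option set" where
  "dirs K N i0 = insert None (Some ` (SIGMA k:K. {1..N k} - {i0 k}))"

lemma finite_multi_indices [simp]: "finite K \<Longrightarrow> finite (multi_indices K N)"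
  by (simp add: multi_indices_def finite_PiE)

lemma card_multi_indices: "finite K \<Longrightarrow> card (multi_indices K N) = (\<Prod>k\<in>K. N k)"
  by (simp add: multi_indices_def card_PiE)

lemma finite_dirs [simp]: "finite K \<Longrightarrow> finite (dirs K N i0)"
  by (simp add: dirs_def)

lemma in_dirs [simp]:
  "None \<in> dirs K N i0"
  "Some (k, i) \<in> dirs K N i0 \<longleftrightarrow> k \<in> K \<and> 1 \<le> i \<and> i \<le> N k \<and> i \<noteq> i0 k"
  by (auto simp: dirs_def)

lemma dirs_mono: "K \<subseteq> K' \<Longrightarrow> dirs K N i0 \<subseteq> dirs K' N i0"
  by (auto simp: dirs_def)

lemma card_dirs:
  assumes "finite K" "\<And>k. k \<in> K \<Longrightarrow> i0 k \<in> {1..N k}"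
  shows "card (dirs K N i0) = 1 + (\<Sum>k\<in>K. N k - 1)"
proof -
  have "card (Some ` (SIGMA k:K. {1..N k} - {i0 k})) = card (SIGMA k:K. {1..N k} - {i0 k})"
    by (rule card_image) simp
  also have "\<dots> = (\<Sum>k\<in>K. N k - 1)"
    using assms by (subst card_SigmaI) (auto intro!: sum.cong)
  finally show ?thesis using assms(1) unfolding dirs_def
    by (subst card_insert_disjoint) auto
qed

lemma polyfun_tangent:
  assumes "\<And>k. polyfun (\<lambda>t. X t k (\<iota> k))"
  shows "polyfun (\<lambda>t. tangent K (X t) \<delta> \<iota>)"
proof (cases \<delta>)
  case None
  then show ?thesis using assms by (simp add: polyfun_prod)
next
  case (Some d)
  then show ?thesis using assms
    by (cases d) (simp add: polyfun_prod polyfun_mult)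
qed

text \<open>\<open>x (p, k, i)\<close> is entry i of the mode-k factor of point p. All points are
  packed into one function so that \<open>generic\<close> applies to it.\<close>

definition tangent_indep ::
  "nat set \<Rightarrow> (nat \<Rightarrow> nat) \<Rightarrow> nat set \<Rightarrow> (nat \<times> nat \<times> nat \<Rightarrow> real) \<Rightarrow> (nat \<Rightarrow> nat \<Rightarrow> nat) \<Rightarrow> bool" where
  "tangent_indep K N P x i0 \<longleftrightarrow>
     indep_on (multi_indices K N) (SIGMA p:P. dirs K N (i0 p)) (\<lambda>(p, \<delta>). tangent K (\<lambda>k i. x (p, k, i)) \<delta>)"

text \<open>By Terracini's lemma, the s-th secant variety then has dimension
  \<open>s * (1 + (\<Sum>k\<in>K. N k - 1))\<close>. This leaves out the case, usually also called
  nondefective, in which that number exceeds the dimension of the space and the secants fill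
  it.\<close>

definition nondefective :: "nat set \<Rightarrow> (nat \<Rightarrow> nat) \<Rightarrow> nat \<Rightarrow> bool" where
  "nondefective K N s \<longleftrightarrow>
     (\<exists>x i0. (\<forall>p k. p < s \<longrightarrow> k \<in> K \<longrightarrow> i0 p k \<in> {1..N k}) \<and> tangent_indep K N {..<s} x i0)"

lemma nondefective_mono:
  assumes "nondefective K N s" "s' \<le> s" "finite K"
  shows "nondefective K N s'"
proof -
  obtain x i0 where *: "\<And>p k. p < s \<Longrightarrow> k \<in> K \<Longrightarrow> i0 p k \<in> {1..N k}" "tangent_indep K N {..<s} x i0"
    using assms(1) by (auto simp: nondefective_def)
  have "tangent_indep K N {..<s'} x i0"
    using *(2) assms(2,3) unfolding tangent_indep_def
    by (elim indep_on_subset) (auto intro!: finite_SigmaI)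
  then show ?thesis using * assms(2) unfolding nondefective_def
    by (intro exI[of _ x] exI[of _ i0]) auto
qed

text \<open>The entries pass through \<open>X\<close> so that some of them can be frozen: the
  three-mode construction keeps the first-mode vectors fixed and varies the other factors
  only.\<close>

lemma tangent_generic:
  assumes "finite J" "\<And>x y p k i. polyfun (\<lambda>t. X (\<lambda>b. (1 - t) * x b + t * y b) p k i)"
  shows "generic (\<lambda>x. indep_on I J (\<lambda>(p, \<delta>). tangent K (X x p) \<delta>))"
  unfolding generic_def
proof (intro allI impI)
  fix x y assume *: "indep_on I J (\<lambda>(p, \<delta>). tangent K (X x p) \<delta>)"
  show "finite {t. \<not> indep_on I J (\<lambda>(p, \<delta>). tangent K (X (\<lambda>b. (1 - t) * x b + t * y b) p) \<delta>)}"
    by (rule indep_on_generic[where ?t0.0 = 0]) (use assms * in \<open>auto intro!: polyfun_tangent\<close>)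
qed

lemma multi_indices_insert_upd:
  assumes "\<iota> \<in> multi_indices K N" "1 \<le> i" "i \<le> N l"
  shows "\<iota>(l := i) \<in> multi_indices (insert l K) N"
  using assms unfolding multi_indices_def by (intro PiE_fun_upd) auto

lemma prod_of_bool: "finite A \<Longrightarrow> (\<Prod>a\<in>A. of_bool (Q a) :: real) = of_bool (\<forall>a\<in>A. Q a)"
  by (induction A rule: finite_induct) auto

lemma tangent_None_delta:
  assumes "finite K" "\<iota> \<in> multi_indices K N" "\<kappa> \<in> multi_indices K N"
  shows "tangent K (\<lambda>k i. of_bool (i = \<kappa> k)) None \<iota> = of_bool (\<iota> = \<kappa>)"
proof -
  have "(\<forall>k\<in>K. \<iota> k = \<kappa> k) \<longleftrightarrow> \<iota> = \<kappa>"
    using assms(2,3) unfolding multi_indices_def by (auto intro: PiE_ext)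
  then show ?thesis using assms(1) by (simp add: prod_of_bool)
qed

text \<open>Rank-one coordinate tensors at non-pivot positions extend an independent family, so
  general rank-one tensors are independent of a tangent space as long as the count permits.\<close>

lemma tangent_indep_extend:
  assumes "finite K" "finite P" "tangent_indep K N P x i0"
    and "\<And>p k. p \<in> P \<Longrightarrow> k \<in> K \<Longrightarrow> i0 p k \<in> {1..N k}"
    and "finite R" "P \<inter> R = {}"
    and "card P * (1 + (\<Sum>k\<in>K. N k - 1)) + card R \<le> (\<Prod>k\<in>K. N k)"
  shows "\<exists>x. indep_on (multi_indices K N) (SIGMA p:P \<union> R. if p \<in> P then dirs K N (i0 p) else {None})
     (\<lambda>(p, \<delta>). tangent K (\<lambda>k i. x (p, k, i)) \<delta>)"
proof -
  let ?J = "SIGMA p:P. dirs K N (i0 p)"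
  let ?v = "\<lambda>x (p, \<delta>). tangent K (\<lambda>k i. x (p, k, i)) \<delta>"
  have finJ: "finite ?J" using assms by auto
  have cardJ: "card ?J = card P * (1 + (\<Sum>k\<in>K. N k - 1))"
    using assms by (subst card_SigmaI) (auto simp: card_dirs)
  obtain I0 where I0: "I0 \<subseteq> multi_indices K N" "finite I0" "card I0 = card ?J" "indep_on I0 ?J (?v x)"
    using indep_on_pivots[OF finJ assms(3)[unfolded tangent_indep_def]] by blast
  have "card R \<le> card (multi_indices K N - I0)"
    using assms I0 cardJ by (simp add: card_Diff_subset card_multi_indices)
  then obtain \<tau> where \<tau>: "\<tau> ` R \<subseteq> multi_indices K N - I0" "inj_on \<tau> R"
    using card_le_inj[of R "multi_indices K N - I0"] assms by auto
  define x' where "x' = (\<lambda>(p, k, i). if p \<in> P then x (p, k, i) else of_bool (i = \<tau> p k))"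
  have x'P: "?v x' (p, \<delta>) = ?v x (p, \<delta>)" if "p \<in> P" for p \<delta>
    using that by (simp add: x'_def)
  have x'R: "?v x' (p, None) \<iota> = of_bool (\<iota> = \<tau> p)" if "p \<in> R" "\<iota> \<in> multi_indices K N" for p \<iota>
  proof -
    have "p \<notin> P" using that assms by auto
    then have "?v x' (p, None) \<iota> = tangent K (\<lambda>k i. of_bool (i = \<tau> p k)) None \<iota>"
      by (simp add: x'_def)
    also have "\<dots> = of_bool (\<iota> = \<tau> p)"
      using that \<tau> assms(1) by (intro tangent_None_delta) auto
    finally show ?thesis .
  qed
  let ?J' = "SIGMA p:P \<union> R. if p \<in> P then dirs K N (i0 p) else {None}"
  have J': "?J' = ?J \<union> R \<times> {None}" using assms(6) by (auto split: if_splits)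
  have disj: "?J \<inter> (R \<times> {None}) = {}" using assms(6) by auto
  have split: "(\<Sum>j\<in>?J'. c j * ?v x' j \<iota>) =
      (\<Sum>j\<in>?J. c j * ?v x j \<iota>) + (\<Sum>p\<in>R. c (p, None) * of_bool (\<iota> = \<tau> p))"
    if "\<iota> \<in> multi_indices K N" for c \<iota>
  proof -
    have "(\<Sum>j\<in>?J'. c j * ?v x' j \<iota>) =
        (\<Sum>j\<in>?J. c j * ?v x' j \<iota>) + (\<Sum>j\<in>R \<times> {None}. c j * ?v x' j \<iota>)"
      unfolding J' using finJ assms(5) disj by (intro sum.union_disjoint) auto
    also have "(\<Sum>j\<in>?J. c j * ?v x' j \<iota>) = (\<Sum>j\<in>?J. c j * ?v x j \<iota>)"
      using x'P by (intro sum.cong) auto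
    also have "R \<times> {None} = (\<lambda>p. (p, None)) ` R" by auto
    also have "(\<Sum>j\<in>(\<lambda>p. (p, None)) ` R. c j * ?v x' j \<iota>) = (\<Sum>p\<in>R. c (p, None) * ?v x' (p, None) \<iota>)"
      by (subst sum.reindex) (auto simp: inj_on_def)
    also have "\<dots> = (\<Sum>p\<in>R. c (p, None) * of_bool (\<iota> = \<tau> p))"
      using x'R that by (intro sum.cong refl) (metis)
    finally show ?thesis .
  qed
  have "indep_on (multi_indices K N) ?J' (?v x')"
  proof (rule indep_onI)
    fix c j
    assume "\<And>\<iota>. \<iota> \<in> multi_indices K N \<Longrightarrow> (\<Sum>j\<in>?J'. c j * ?v x' j \<iota>) = 0" and j: "j \<in> ?J'"
    then have c: "(\<Sum>j\<in>?J. c j * ?v x j \<iota>) + (\<Sum>p\<in>R. c (p, None) * of_bool (\<iota> = \<tau> p)) = 0"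
      if "\<iota> \<in> multi_indices K N" for \<iota> using split that by simp
    \<comment> \<open>The positions \<open>\<tau> p\<close> avoid \<open>I0\<close>, so on
      \<open>I0\<close> the relation involves the old family only; the new coefficients are then
      read off at the positions \<open>\<tau> p\<close>.\<close>
    have "(\<Sum>p\<in>R. c (p, None) * of_bool (\<iota> = \<tau> p)) = 0" if "\<iota> \<in> I0" for \<iota>
      using that \<tau> by (intro sum.neutral) auto
    then have "(\<Sum>j\<in>?J. c j * ?v x j \<iota>) = 0" if "\<iota> \<in> I0" for \<iota>
      using c[of \<iota>] that I0(1) by auto
    then have cJ: "c j = 0" if "j \<in> ?J" for j
      using indep_onD[OF I0(4) _ that] by blast
    have "c (p, None) = 0" if p: "p \<in> R" for p
    proof -
      have "(\<Sum>p'\<in>R. c (p', None) * of_bool (\<tau> p = \<tau> p')) = (\<Sum>p'\<in>R. if p' = p then c (p', None) else 0)"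
        using \<tau>(2) p by (intro sum.cong) (auto simp: inj_on_def)
      moreover have "(\<Sum>j\<in>?J. c j * ?v x j (\<tau> p)) = 0"
        by (intro sum.neutral) (simp add: cJ)
      ultimately show ?thesis using c[of "\<tau> p"] \<tau> p assms(5) by auto
    qed
    then show "c j = 0" using cJ j J' by auto
  qed
  then show ?thesis by blast
qed

section \<open>Adding one mode, slice by slice\<close>

lemma bij_betw_Sigma_reindex:
  assumes "bij_betw h A B"
  shows "bij_betw (\<lambda>(p, \<delta>). (h p, \<delta>)) (SIGMA p:A. D (h p)) (SIGMA p:B. D p)"
proof (rule bij_betw_byWitness[where f' = "\<lambda>(p, \<delta>). (inv_into A h p, \<delta>)"])
  have inv: "inv_into A h (h p) = p" if "p \<in> A" for p
    using assms that by (simp add: bij_betw_def)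
  have inv': "h (inv_into A h p) = p" "inv_into A h p \<in> A" if "p \<in> B" for p
    using assms that bij_betw_imp_surj_on[OF assms] by (auto intro: f_inv_into_f inv_into_into)
  have h: "h p \<in> B" if "p \<in> A" for p using assms that by (auto simp: bij_betw_def)
  show "\<forall>j\<in>SIGMA p:A. D (h p). (\<lambda>(p, \<delta>). (inv_into A h p, \<delta>)) ((\<lambda>(p, \<delta>). (h p, \<delta>)) j) = j"
    using inv by auto
  show "\<forall>j\<in>SIGMA p:B. D p. (\<lambda>(p, \<delta>). (h p, \<delta>)) ((\<lambda>(p, \<delta>). (inv_into A h p, \<delta>)) j) = j"
    using inv' by auto
  show "(\<lambda>(p, \<delta>). (h p, \<delta>)) ` (SIGMA p:A. D (h p)) \<subseteq> (SIGMA p:B. D p)"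
    using h by auto
  show "(\<lambda>(p, \<delta>). (inv_into A h p, \<delta>)) ` (SIGMA p:B. D p) \<subseteq> (SIGMA p:A. D (h p))"
    using inv' by auto
qed

lemma tangent_insert:
  assumes "finite K" "l \<notin> K"
  shows "tangent (insert l K) X None \<iota> = X l (\<iota> l) * tangent K X None \<iota>"
    and "tangent (insert l K) X (Some (l, i)) \<iota> = of_bool (\<iota> l = i) * tangent K X None \<iota>"
    and "k \<in> K \<Longrightarrow> tangent (insert l K) X (Some (k, i)) \<iota> = X l (\<iota> l) * tangent K X (Some (k, i)) \<iota>"
proof -
  show "tangent (insert l K) X None \<iota> = X l (\<iota> l) * tangent K X None \<iota>"
    using assms by simp
  show "tangent (insert l K) X (Some (l, i)) \<iota> = of_bool (\<iota> l = i) * tangent K X None \<iota>"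
    using assms by (simp add: insert_Diff_if)
  show "tangent (insert l K) X (Some (k, i)) \<iota> = X l (\<iota> l) * tangent K X (Some (k, i)) \<iota>"
    if "k \<in> K"
  proof -
    have "insert l K - {k} = insert l (K - {k})" using that assms by auto
    then show ?thesis using assms by simp
  qed
qed

lemma tangent_cong:
  assumes "\<And>k i. k \<in> K \<Longrightarrow> X k i = Y k i" "\<And>k. k \<in> K \<Longrightarrow> \<iota> k = \<kappa> k" "\<delta> \<in> dirs K N i0"
  shows "tangent K X \<delta> \<iota> = tangent K Y \<delta> \<kappa>"
proof (cases \<delta>)
  case None
  then show ?thesis using assms by simp
next
  case (Some d)
  then show ?thesis using assms by (cases d) (auto intro!: prod.cong)
qed

lemma nondefective_step:
  assumes "finite K" "l \<notin> K" "nondefective K N q"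
    and "q * (1 + (\<Sum>k\<in>K. N k - 1)) + (N l - 1) * q \<le> (\<Prod>k\<in>K. N k)"
  shows "nondefective (insert l K) N (N l * q)"
proof -
  obtain x0 i0 where i0: "\<And>p k. p < q \<Longrightarrow> k \<in> K \<Longrightarrow> i0 p k \<in> {1..N k}"
    and x0: "tangent_indep K N {..<q} x0 i0"
    using assms(3) by (auto simp: nondefective_def)
  \<comment> \<open>Point p lies on the axis of row \<open>p div q + 1\<close> of mode
    \<open>l\<close>, and within its axis it plays the role of point \<open>p mod q\<close> of the
    smaller family.\<close>
  let ?P = "{..<N l * q}"
  have div: "p div q < N l" "p mod q < q" if "p \<in> ?P" for p
  proof -
    have "q > 0" using that by (cases q) auto
    then show "p mod q < q" by simp
    show "p div q < N l" using that by (simp add: less_mult_imp_div_less)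
  qed
  let ?J = "\<lambda>g. SIGMA p:?P. if p div q = g then dirs K N (i0 (p mod q)) else {None}"
  define C where "C g x \<longleftrightarrow> indep_on (multi_indices K N) (?J g)
    (\<lambda>(p, \<delta>). tangent K (\<lambda>k i. x (p, k, i)) \<delta>)" for g and x :: "nat \<times> nat \<times> nat \<Rightarrow> real"
  \<comment> \<open>The factors x in the modes \<open>K\<close> are shared by all slices, while each
    witness below serves a single slice; genericity reconciles them.\<close>
  have "\<exists>x. \<forall>g\<in>{..<N l}. C g x"
  proof (rule generic_common_point)
    show "generic (C g)" for g
      unfolding C_def using assms(1)
      by (intro tangent_generic finite_SigmaI) (auto intro!: polyfun_add polyfun_mult polyfun_diff)
    show "\<exists>x. C g x" if "g \<in> {..<N l}" for g
    proof -
      let ?P1 = "{p\<in>?P. p div q = g}"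
      let ?P2 = "{p\<in>?P. p div q \<noteq> g}"
      have bij: "bij_betw (\<lambda>p. p mod q) ?P1 {..<q}"
      proof (rule bij_betw_byWitness[where f' = "\<lambda>s. g * q + s"])
        show "\<forall>p\<in>?P1. g * q + p mod q = p" by auto
        show "\<forall>s\<in>{..<q}. (g * q + s) mod q = s" by auto
        show "(\<lambda>p. p mod q) ` ?P1 \<subseteq> {..<q}" using div by auto
        have "g * q + s < N l * q" if "s < q" for s
        proof -
          have "g * q + s < (g + 1) * q" using that by simp
          also have "\<dots> \<le> N l * q" using \<open>g \<in> {..<N l}\<close> by (intro mult_right_mono) auto
          finally show ?thesis .
        qed
        then show "(\<lambda>s. g * q + s) ` {..<q} \<subseteq> ?P1" by auto
      qed
      have card1: "card ?P1 = q" using bij_betw_same_card[OF bij] by simp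
      have "card ?P1 + card ?P2 = card (?P1 \<union> ?P2)"
        by (rule card_Un_disjoint[symmetric]) auto
      also have "?P1 \<union> ?P2 = ?P" by auto
      finally have card2: "card ?P2 = (N l - 1) * q"
        using card1 by (simp add: algebra_simps)
      have "tangent_indep K N ?P1 (\<lambda>(p, k, i). x0 (p mod q, k, i)) (\<lambda>p. i0 (p mod q))"
        unfolding tangent_indep_def
      proof (rule indep_on_transfer[OF x0[unfolded tangent_indep_def]])
        show "bij_betw (\<lambda>(p, \<delta>). (p mod q, \<delta>)) (SIGMA p:?P1. dirs K N (i0 (p mod q)))
          (SIGMA p:{..<q}. dirs K N (i0 p))"
          by (rule bij_betw_Sigma_reindex[OF bij])
      qed auto
      from tangent_indep_extend[OF assms(1) _ this, of ?P2] i0 div card1 card2 assms(4)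
      obtain x where x: "indep_on (multi_indices K N)
        (SIGMA p:?P1 \<union> ?P2. if p \<in> ?P1 then dirs K N (i0 (p mod q)) else {None})
        (\<lambda>(p, \<delta>). tangent K (\<lambda>k i. x (p, k, i)) \<delta>)" by auto
      have "(SIGMA p:?P1 \<union> ?P2. if p \<in> ?P1 then dirs K N (i0 (p mod q)) else {None}) = ?J g"
        by (rule Sigma_cong) auto
      then show ?thesis using x unfolding C_def by metis
    qed
  qed simp
  then obtain x where x: "\<And>g. g < N l \<Longrightarrow> C g x" by auto
  define x' where "x' = (\<lambda>(p, k, i). if k = l then of_bool (i = p div q + 1) else x (p, k, i))"
  \<comment> \<open>With the row of its own axis left out, the mode-\<open>l\<close> directions of p
    correspond exactly to the slices it does not belong to, one each.\<close>
  define i0' where "i0' p k = (if k = l then p div q + 1 else i0 (p mod q) k)" for p k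
  have dirsK: "dirs K N (i0' p) = dirs K N (i0 (p mod q))" for p
    using assms(2) unfolding dirs_def i0'_def by (intro arg_cong[where f = "insert None"]) (auto simp: image_iff)
  let ?K = "insert l K"
  let ?S = "\<lambda>g. SIGMA p:?P. if p div q = g then dirs K N (i0' p) else {Some (l, g + 1)}"
  let ?v = "\<lambda>(p, \<delta>). tangent ?K (\<lambda>k i. x' (p, k, i)) \<delta>"
  have x'l: "x' (p, l, i) = of_bool (i = p div q + 1)" for p i by (simp add: x'_def)
  have dirs_insert: "\<delta> \<in> dirs K N (i0' p) \<or> (\<exists>i. \<delta> = Some (l, i) \<and> i \<in> {1..N l} \<and> i \<noteq> p div q + 1)"
    if "\<delta> \<in> dirs ?K N (i0' p)" for \<delta> p
    using that by (auto simp: dirs_def i0'_def)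
  have "tangent_indep ?K N ?P x' i0'"
    unfolding tangent_indep_def
  proof (rule indep_on_slices[where G = "{..<N l}" and S = ?S
      and I' = "\<lambda>g. {\<iota> \<in> multi_indices ?K N. \<iota> l = g + 1}"])
    fix j assume j: "j \<in> (SIGMA p:?P. dirs ?K N (i0' p))"
    obtain p \<delta> where p: "j = (p, \<delta>)" "p \<in> ?P" "\<delta> \<in> dirs ?K N (i0' p)" using j by auto
    from dirs_insert[OF p(3)] show "\<exists>g\<in>{..<N l}. j \<in> ?S g"
    proof
      assume "\<delta> \<in> dirs K N (i0' p)"
      then show ?thesis using p div by (intro bexI[of _ "p div q"]) auto
    next
      assume "\<exists>i. \<delta> = Some (l, i) \<and> i \<in> {1..N l} \<and> i \<noteq> p div q + 1"
      then obtain i where "\<delta> = Some (l, i)" "i \<in> {1..N l}" "i \<noteq> p div q + 1" by blast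
      then show ?thesis using p by (intro bexI[of _ "i - 1"]) auto
    qed
  next
    fix g assume g: "g \<in> {..<N l}"
    show "?S g \<subseteq> (SIGMA p:?P. dirs ?K N (i0' p))"
    proof
      fix j assume j: "j \<in> ?S g"
      obtain p \<delta> where p: "j = (p, \<delta>)" "p \<in> ?P" by (use j in auto)
      have sub: "dirs K N (i0' p) \<subseteq> dirs ?K N (i0' p)" by (rule dirs_mono) auto
      have "\<delta> \<in> dirs ?K N (i0' p)"
      proof (cases "p div q = g")
        case True
        then show ?thesis using j p sub by auto
      next
        case False
        then have "\<delta> = Some (l, g + 1)" using j p by auto
        then show ?thesis using g False by (simp add: i0'_def)
      qed
      then show "j \<in> (SIGMA p:?P. dirs ?K N (i0' p))" using p by auto
    qed
  next
    fix g j \<iota> assume g: "g \<in> {..<N l}" "\<iota> \<in> {\<iota> \<in> multi_indices ?K N. \<iota> l = g + 1}"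
      "j \<in> (SIGMA p:?P. dirs ?K N (i0' p))" "j \<notin> ?S g"
    then obtain p \<delta> where p: "j = (p, \<delta>)" "p \<in> ?P" "\<delta> \<in> dirs ?K N (i0' p)" by auto
    have \<iota>l: "\<iota> l = g + 1" using g by simp
    have "tangent ?K (\<lambda>k i. x' (p, k, i)) \<delta> \<iota> = 0"
    proof (cases "\<exists>i. \<delta> = Some (l, i)")
      case True
      then obtain i where \<delta>: "\<delta> = Some (l, i)" by blast
      have "i \<noteq> g + 1" using g(4) p \<delta> by (auto simp: i0'_def split: if_splits)
      then show ?thesis using \<delta> \<iota>l by (simp add: tangent_insert[OF assms(1,2)])
    next
      case False
      then have "\<delta> \<in> dirs K N (i0' p)" using dirs_insert[OF p(3)] by blast
      then have ne: "p div q \<noteq> g" using g(4) p by auto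
      show ?thesis
      proof (cases \<delta>)
        case None
        then show ?thesis using ne \<iota>l assms(1,2) by (simp add: x'l)
      next
        case (Some d)
        then obtain k i where "\<delta> = Some (k, i)" "k \<in> K"
          using \<open>\<delta> \<in> dirs K N (i0' p)\<close> by (auto simp: dirs_def)
        then show ?thesis using ne \<iota>l
          by (simp add: tangent_insert(3)[OF assms(1,2)] x'l del: tangent.simps)
      qed
    qed
    then show "?v j \<iota> = 0" using p by simp
  next
    fix g assume g: "g \<in> {..<N l}"
    then have Cg: "C g x" using x by simp
    \<comment> \<open>In slice \<open>g + 1\<close> the direction \<open>Some (l, g + 1)\<close> of
      a point from another axis is its rank-one tensor in the modes \<open>K\<close>, hence
      corresponds to \<open>None\<close>.\<close>
    define f where "f = (\<lambda>(p, \<delta> :: (nat \<times> nat) option). (p, if p div q = g then \<delta> else None))"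
    show "indep_on {\<iota> \<in> multi_indices ?K N. \<iota> l = g + 1} (?S g) ?v"
    proof (rule indep_on_transfer[OF Cg[unfolded C_def], where f = f])
      show "bij_betw f (?S g) (?J g)"
        by (rule bij_betw_byWitness[where f' = "\<lambda>(p, \<delta>). (p, if p div q = g then \<delta> else Some (l, g + 1))"])
          (auto simp: f_def dirsK split: if_splits)
      fix \<iota>' assume \<iota>': "\<iota>' \<in> multi_indices K N"
      let ?\<iota> = "\<iota>'(l := g + 1)"
      have "?\<iota> \<in> multi_indices ?K N" using \<iota>' g by (intro multi_indices_insert_upd) auto
      moreover have "?v j ?\<iota> = (\<lambda>(p, \<delta>). tangent K (\<lambda>k i. x (p, k, i)) \<delta>) (f j) \<iota>'" if j: "j \<in> ?S g" for j
      proof -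
        obtain p \<delta> where p: "j = (p, \<delta>)" "p \<in> ?P" using j by auto
        have eq: "tangent K (\<lambda>k i. x' (p, k, i)) \<delta>' ?\<iota> = tangent K (\<lambda>k i. x (p, k, i)) \<delta>' \<iota>'"
          if "\<delta>' \<in> dirs K N (i0' p)" for \<delta>'
          using assms(2) that by (intro tangent_cong[of K _ _ _ _ _ N "i0' p"]) (auto simp: x'_def)
        show ?thesis
        proof (cases "p div q = g")
          case True
          then have \<delta>: "\<delta> \<in> dirs K N (i0' p)" using j p by auto
          have "tangent ?K (\<lambda>k i. x' (p, k, i)) \<delta> ?\<iota> = tangent K (\<lambda>k i. x' (p, k, i)) \<delta> ?\<iota>"
          proof (cases \<delta>)
            case None
            then show ?thesis using True by (simp add: tangent_insert[OF assms(1,2)] x'l del: tangent.simps)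
          next
            case (Some d)
            then obtain k i where "\<delta> = Some (k, i)" "k \<in> K" using \<delta> by (auto simp: dirs_def)
            then show ?thesis using True
              by (simp add: tangent_insert(3)[OF assms(1,2)] x'l del: tangent.simps)
          qed
          then show ?thesis using True eq[OF \<delta>] p by (simp add: f_def)
        next
          case False
          then have "\<delta> = Some (l, g + 1)" using j p by auto
          then show ?thesis using False eq[of None] p
            by (simp add: f_def tangent_insert[OF assms(1,2)] del: tangent.simps)
        qed
      qed
      ultimately show "\<exists>\<iota>\<in>{\<iota> \<in> multi_indices ?K N. \<iota> l = g + 1}.
          \<forall>j\<in>?S g. ?v j \<iota> = (\<lambda>(p, \<delta>). tangent K (\<lambda>k i. x (p, k, i)) \<delta>) (f j) \<iota>'"
        by (intro bexI[of _ ?\<iota>]) auto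
    qed
  qed (use assms(1) in auto)
  moreover have "i0' p k \<in> {1..N k}" if "p < N l * q" "k \<in> ?K" for p k
    using that div[of p] i0[of "p mod q" k] by (auto simp: i0'_def)
  ultimately show ?thesis unfolding nondefective_def by blast
qed

section \<open>Three modes\<close>

text \<open>Representatives of the pairs 2 t - 1, 2 t up to 2 q. The indicators of the fibres are
  sums of two paired unit vectors, or single unit vectors beyond 2 q; they are the factors of the
  points foreign to a block.\<close>

definition pair_top :: "nat \<Rightarrow> nat \<Rightarrow> nat" where
  "pair_top q i = (if i \<le> 2 * q then 2 * ((i + 1) div 2) else i)"

lemma pair_top_le: "pair_top q i \<le> 2 * q \<longleftrightarrow> i \<le> 2 * q"
  unfolding pair_top_def by auto

lemma pair_top_partner:
  assumes "1 \<le> i" "i \<le> 2 * q"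
  shows "\<exists>i'. 1 \<le> i' \<and> i' \<le> 2 * q \<and> i' \<noteq> i \<and> pair_top q i' = pair_top q i"
proof (cases "even i")
  case True
  then show ?thesis using assms by (intro exI[of _ "i - 1"]) (auto simp: pair_top_def elim!: evenE)
next
  case False
  then have "i + 1 \<le> 2 * q" using assms by presburger
  then show ?thesis using assms False by (intro exI[of _ "i + 1"]) (auto simp: pair_top_def elim!: oddE)
qed

text \<open>
  \<open>b\<close> numbers the two slices of a pencil. At each entry \<open>(i, j)\<close> the relation involves at most two
  points of the block; where exactly one index exceeds \<open>2 q\<close>, comparing the two rows (columns) of a
  pair gives four equations for four unknowns, regular because their multipliers are distinct.
\<close>

lemma pencil_relation_trivial:
  fixes A :: "nat \<Rightarrow> nat \<Rightarrow> real" and \<gamma> :: "nat \<Rightarrow> nat \<times> nat \<Rightarrow> real"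
  assumes A: "\<And>s. A 1 s = 1" "\<And>s. A 2 s = real s"
    and n: "2 * q \<le> n2" "2 * q \<le> n3"
    and \<gamma>: "\<forall>b. \<forall>i\<le>2 * q. \<forall>j\<le>2 * q. \<gamma> b (i, j) = 0"
    and rel: "\<forall>b\<in>{1, 2}. \<forall>i\<in>{1..n2}. \<forall>j\<in>{1..n3}.
      (if j \<le> 2 * q \<and> i \<noteq> j then A b j * B j i else 0) +
      (if i \<le> 2 * q \<and> i \<noteq> j then A b i * C i j else 0) +
      (if i = j \<and> i \<le> 2 * q then A b i * D i + (if b = 2 then E i else 0) else 0) +
      \<gamma> b (pair_top q i, pair_top q j) = 0"
  shows "s \<in> {1..2 * q} \<Longrightarrow> D s = 0"
    and "s \<in> {1..2 * q} \<Longrightarrow> E s = 0"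
    and "s \<in> {1..2 * q} \<Longrightarrow> i \<in> {1..n2} \<Longrightarrow> i \<noteq> s \<Longrightarrow> B s i = 0"
    and "s \<in> {1..2 * q} \<Longrightarrow> j \<in> {1..n3} \<Longrightarrow> j \<noteq> s \<Longrightarrow> C s j = 0"
    and "b \<in> {1, 2} \<Longrightarrow> i \<in> {1..n2} \<Longrightarrow> j \<in> {1..n3} \<Longrightarrow> \<gamma> b (pair_top q i, pair_top q j) = 0"
proof -
  have \<gamma>0: "\<gamma> b (pair_top q i, pair_top q j) = 0" if "i \<le> 2 * q" "j \<le> 2 * q" for b i j
    using that by (simp add: \<gamma> pair_top_le)
  note eq = rel[rule_format]
  have D: "D s = 0 \<and> E s = 0" if "s \<in> {1..2 * q}" for s
    using eq[of 1 s s] eq[of 2 s s] that n A \<gamma>0 by auto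
  \<comment> \<open>Inside the square only the points i and j reach the entry (i, j), and the two
    slices give a linear system with determinant i - j.\<close>
  have off: "B j i = 0 \<and> C i j = 0" if "i \<in> {1..2 * q}" "j \<in> {1..2 * q}" "i \<noteq> j" for i j
  proof -
    have "B j i + C i j = 0" "real j * B j i + real i * C i j = 0"
      using eq[of 1 i j] eq[of 2 i j] that n A \<gamma>0 by auto
    then have "(real j - real i) * B j i = 0" "B j i + C i j = 0" by (algebra, simp)
    then show ?thesis using that by auto
  qed
  have solve: "c = 0 \<and> y 1 = 0 \<and> y 2 = 0"
    if "c + y 1 = 0" "real i * c + y 2 = 0" "c' + y 1 = 0" "real i' * c' + y 2 = 0" "i \<noteq> i'"
    for c c' :: real and y :: "nat \<Rightarrow> real" and i i' :: nat
  proof -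
    have "c' = c" using that(1,3) by linarith
    have "real i * c = real i' * c" using that(2) that(4)[unfolded \<open>c' = c\<close>] by linarith
    then show ?thesis using that by auto
  qed
  have right: "C i j = 0 \<and> \<gamma> 1 (pair_top q i, pair_top q j) = 0 \<and> \<gamma> 2 (pair_top q i, pair_top q j) = 0"
    if "i \<in> {1..2 * q}" "j \<in> {1..n3}" "2 * q < j" for i j
  proof -
    note prem = that
    obtain i' where i': "1 \<le> i'" "i' \<le> 2 * q" "i' \<noteq> i" "pair_top q i' = pair_top q i"
      using pair_top_partner[of i q] prem(1) by auto
    let ?y = "\<lambda>b. \<gamma> b (pair_top q i, pair_top q j)"
    have "C i j + ?y 1 = 0" "real i * C i j + ?y 2 = 0"
      using eq[of 1 i j] eq[of 2 i j] that n A by auto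
    moreover have "C i' j + ?y 1 = 0" "real i' * C i' j + ?y 2 = 0"
      using eq[of 1 i' j] eq[of 2 i' j] that n A i' by auto
    ultimately show ?thesis
      using solve[of "C i j" ?y i "C i' j" i'] i'(3) by blast
  qed
  have left: "B j i = 0 \<and> \<gamma> 1 (pair_top q i, pair_top q j) = 0 \<and> \<gamma> 2 (pair_top q i, pair_top q j) = 0"
    if "j \<in> {1..2 * q}" "i \<in> {1..n2}" "2 * q < i" for i j
  proof -
    note prem = that
    obtain j' where j': "1 \<le> j'" "j' \<le> 2 * q" "j' \<noteq> j" "pair_top q j' = pair_top q j"
      using pair_top_partner[of j q] prem(1) by auto
    let ?y = "\<lambda>b. \<gamma> b (pair_top q i, pair_top q j)"
    have "B j i + ?y 1 = 0" "real j * B j i + ?y 2 = 0"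
      using eq[of 1 i j] eq[of 2 i j] that n A by auto
    moreover have "B j' i + ?y 1 = 0" "real j' * B j' i + ?y 2 = 0"
      using eq[of 1 i j'] eq[of 2 i j'] that n A j' by auto
    ultimately show ?thesis
      using solve[of "B j i" ?y j "B j' i" j'] j'(3) by blast
  qed
  show "s \<in> {1..2 * q} \<Longrightarrow> D s = 0" "s \<in> {1..2 * q} \<Longrightarrow> E s = 0" using D by auto
  show "s \<in> {1..2 * q} \<Longrightarrow> i \<in> {1..n2} \<Longrightarrow> i \<noteq> s \<Longrightarrow> B s i = 0"
    using off[of i s] left[of s i] by (cases "i \<le> 2 * q") auto
  show "s \<in> {1..2 * q} \<Longrightarrow> j \<in> {1..n3} \<Longrightarrow> j \<noteq> s \<Longrightarrow> C s j = 0"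
    using off[of s j] right[of s j] by (cases "j \<le> 2 * q") auto
  show "\<gamma> b (pair_top q i, pair_top q j) = 0" if "b \<in> {1, 2}" "i \<in> {1..n2}" "j \<in> {1..n3}"
  proof (cases "i \<le> 2 * q"; cases "j \<le> 2 * q")
    assume "\<not> i \<le> 2 * q" "\<not> j \<le> 2 * q"
    then show ?thesis using eq[OF that] by auto
  qed (use \<gamma>0 right[of i j] left[of j i] that in auto)
qed

text \<open>There are (n2 - q) (n3 - q) pair positions, less the q^2 inside the square of side 2 q.
  The construction wastes nothing: the 2 q own points of a block use 2 q (n2 + n3) of the 2 n2 n3
  coordinates in its two slices, and each foreign point uses two of the rest.\<close>

lemma card_pair_positions:
  assumes "2 * q \<le> n2" "2 * q \<le> n3"
  shows "card {(i, j). i \<in> {1..n2} \<and> j \<in> {1..n3} \<and> pair_top q i = i \<and> pair_top q j = j \<and>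
    \<not> (i \<le> 2 * q \<and> j \<le> 2 * q)} = n2 * n3 - q * (n2 + n3)" (is "card ?T = _")
proof -
  let ?E = "\<lambda>n. {i \<in> {1..n}. pair_top q i = i}"
  have E: "card (?E n) = n - q" if "2 * q \<le> n" for n
  proof -
    have "?E n = (\<lambda>i. 2 * i) ` {1..q} \<union> {2 * q + 1..n}"
      using that by (auto simp: pair_top_def image_iff Bex_def elim!: evenE split: if_splits; presburger)
    moreover have "card ((\<lambda>i. 2 * i) ` {1..q} \<union> {2 * q + 1..n}) = card ((\<lambda>i. 2 * i) ` {1..q}) + card {2 * q + 1..n}"
      by (rule card_Un_disjoint) auto
    moreover have "card ((\<lambda>i::nat. 2 * i) ` {1..q}) = q"
      by (subst card_image) (auto simp: inj_on_def)
    ultimately show ?thesis using that by simp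
  qed
  have sub: "?E (2 * q) \<times> ?E (2 * q) \<subseteq> ?E n2 \<times> ?E n3" using assms by auto
  have "?T = ?E n2 \<times> ?E n3 - ?E (2 * q) \<times> ?E (2 * q)" by auto
  then have "card ?T = card (?E n2 \<times> ?E n3) - card (?E (2 * q) \<times> ?E (2 * q))"
    using card_Diff_subset[OF _ sub] by simp
  also have "\<dots> = (n2 - q) * (n3 - q) - q * q"
    using E[OF assms(1)] E[OF assms(2)] E[of "2 * q"] by (simp only: card_cartesian_product) simp
  also have "\<dots> = n2 * n3 - q * (n2 + n3)"
  proof -
    obtain a b where "n2 = 2 * q + a" "n3 = 2 * q + b"
      using assms by (metis le_Suc_ex)
    then show ?thesis by (simp add: algebra_simps)
  qed
  finally show ?thesis .
qed

section \<open>One block of two slices\<close>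

lemma mod_div_block:
  fixes s q g :: nat
  assumes "s < q"
  shows "(g * q + s) div q = g" "(g * q + s) mod q = s"
  using assms by auto

text \<open>For an own point (\<open>p div Q = g\<close>) row \<open>2 * g + 1\<close> of mode
  \<open>l\<close> is the one omitted from the tangent basis, so \<open>2 * g + 2\<close> is its
  only mode-\<open>l\<close> direction visible in this block. A foreign point has zero
  mode-\<open>l\<close> entries on both slices and keeps just its two directions there, each a
  rank-one matrix in one slice.\<close>

lemma pencil_block_indep:
  fixes l l2 l3 :: nat and N :: "nat \<Rightarrow> nat" and q h g :: nat
  defines "Q \<equiv> 2 * q" and "K \<equiv> {l2, l3}"
  defines "\<alpha> \<equiv> \<lambda>p i. if i = 2 * (p div Q) + 1 then 1
      else if i = 2 * (p div Q) + 2 then real (p mod Q + 1) else (0 :: real)"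
  assumes distinct: "l \<noteq> l2" "l \<noteq> l3" "l2 \<noteq> l3"
    and Nl: "2 * h \<le> N l" and g: "g < h" and N23: "Q \<le> N l2" "Q \<le> N l3"
    and count: "(h - 1) * Q + q * (N l2 + N l3) \<le> N l2 * N l3"
  shows "\<exists>x. indep_on {\<iota> \<in> multi_indices (insert l K) N. \<iota> l \<in> {2 * g + 1, 2 * g + 2}}
    (SIGMA p:{..<h * Q}. if p div Q = g then insert (Some (l, 2 * g + 2)) (dirs K N (\<lambda>_. p mod Q + 1))
       else {Some (l, 2 * g + 1), Some (l, 2 * g + 2)})
    (\<lambda>(p, \<delta>). tangent (insert l K) (\<lambda>k i. if k = l then \<alpha> p i else x (p, k, i)) \<delta>)"
proof -
  let ?P = "{..<h * Q}"
  let ?P1 = "{p\<in>?P. p div Q = g}"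
  let ?P2 = "{p\<in>?P. p div Q \<noteq> g}"
  let ?T = "{(i, j). i \<in> {1..N l2} \<and> j \<in> {1..N l3} \<and> pair_top q i = i \<and> pair_top q j = j \<and>
    \<not> (i \<le> 2 * q \<and> j \<le> 2 * q)}"
  \<comment> \<open>The 1-based number s of an own point is at once its multiplier in the second
    slice and the position of its unit vectors in the modes \<open>l2\<close> and
    \<open>l3\<close>.\<close>
  define pt where "pt s = g * Q + (s - 1)" for s
  have gQ: "g * Q + Q \<le> h * Q" using mult_right_mono[of "g + 1" h Q] g by simp
  have pt_div: "pt s div Q = g" "pt s mod Q + 1 = s" if "s \<in> {1..Q}" for s
  proof -
    have *: "s - 1 < Q" using that by auto
    show "pt s div Q = g" unfolding pt_def by (rule mod_div_block(1)[OF *])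
    show "pt s mod Q + 1 = s" unfolding pt_def mod_div_block(2)[OF *] using that by simp
  qed
  have bij: "bij_betw pt {1..Q} ?P1"
  proof (rule bij_betw_byWitness[where f' = "\<lambda>p. p mod Q + 1"])
    show "\<forall>s\<in>{1..Q}. pt s mod Q + 1 = s" using pt_div by auto
    show "\<forall>p\<in>?P1. pt (p mod Q + 1) = p" by (auto simp: pt_def)
    show "pt ` {1..Q} \<subseteq> ?P1"
    proof (rule image_subsetI)
      fix s assume s: "s \<in> {1..Q}"
      have "pt s < h * Q" using s gQ by (auto simp: pt_def)
      then show "pt s \<in> ?P1" using pt_div[OF s] by auto
    qed
    have "p mod Q < Q" if "p \<in> ?P1" for p
      using that by (cases "Q = 0") auto
    then show "(\<lambda>p. p mod Q + 1) ` ?P1 \<subseteq> {1..Q}" by (auto simp: Suc_le_eq)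
  qed
  have "card ?P1 = Q" using bij_betw_same_card[OF bij] by simp
  moreover have "card ?P1 + card ?P2 = card (?P1 \<union> ?P2)"
    by (rule card_Un_disjoint[symmetric]) auto
  moreover have "?P1 \<union> ?P2 = ?P" by auto
  ultimately have "card ?P2 = (h - 1) * Q" by (simp add: algebra_simps)
  then have "card ?P2 \<le> card ?T"
    using count N23 unfolding Q_def by (subst card_pair_positions) auto
  moreover have "finite ?T" by (rule finite_subset[of _ "{1..N l2} \<times> {1..N l3}"]) auto
  ultimately obtain \<tau> where \<tau>: "\<tau> ` ?P2 \<subseteq> ?T" "inj_on \<tau> ?P2"
    using card_le_inj[of ?P2 ?T] by auto
  have \<tau>T: "\<tau> p \<in> ?T" if "p \<in> ?P2" for p
    using \<tau>(1) that unfolding image_subset_iff by (rule bspec)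
  \<comment> \<open>Own points get unit vectors, a foreign point the indicators of the two
    \<open>pair_top\<close> fibres named by \<open>\<tau> p\<close>. As \<open>\<tau> p\<close> is
    outside the square, foreign contributions vanish where both indices are at most 2 q.\<close>
  define x :: "nat \<times> nat \<times> nat \<Rightarrow> real" where
    "x = (\<lambda>(p, k, i). if p div Q = g then of_bool (i = p mod Q + 1)
      else of_bool (pair_top q i = (if k = l2 then fst (\<tau> p) else snd (\<tau> p))))"
  let ?K = "insert l K"
  let ?S = "SIGMA p:?P. if p div Q = g then insert (Some (l, 2 * g + 2)) (dirs K N (\<lambda>_. p mod Q + 1))
       else {Some (l, 2 * g + 1), Some (l, 2 * g + 2)}"
  let ?X = "\<lambda>p k i. if k = l then \<alpha> p i else x (p, k, i)"
  let ?v = "\<lambda>(p, \<delta>). tangent ?K (?X p) \<delta>"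
  let ?I = "{\<iota> \<in> multi_indices ?K N. \<iota> l \<in> {2 * g + 1, 2 * g + 2}}"
  have finK: "finite K" "l \<notin> K" using distinct by (auto simp: K_def)
  define A where "A b s = (if b = 1 then 1 else real s)" for b s :: nat
  have tK: "tangent K X None \<iota> = X l2 (\<iota> l2) * X l3 (\<iota> l3)"
    "tangent K X (Some (l2, i)) \<iota> = of_bool (\<iota> l2 = i) * X l3 (\<iota> l3)"
    "tangent K X (Some (l3, i)) \<iota> = of_bool (\<iota> l3 = i) * X l2 (\<iota> l2)" for X \<iota> i
  proof -
    have "K - {l2} = {l3}" "K - {l3} = {l2}" using distinct by (auto simp: K_def)
    then show "tangent K X None \<iota> = X l2 (\<iota> l2) * X l3 (\<iota> l3)"
      "tangent K X (Some (l2, i)) \<iota> = of_bool (\<iota> l2 = i) * X l3 (\<iota> l3)"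
      "tangent K X (Some (l3, i)) \<iota> = of_bool (\<iota> l3 = i) * X l2 (\<iota> l2)"
      using distinct by (auto simp: K_def)
  qed
  have in_K: "l2 \<in> K" "l3 \<in> K" by (auto simp: K_def)
  have t: "tangent ?K X None \<iota> = X l (\<iota> l) * X l2 (\<iota> l2) * X l3 (\<iota> l3)"
    "tangent ?K X (Some (l, i)) \<iota> = of_bool (\<iota> l = i) * X l2 (\<iota> l2) * X l3 (\<iota> l3)"
    "tangent ?K X (Some (l2, i)) \<iota> = X l (\<iota> l) * of_bool (\<iota> l2 = i) * X l3 (\<iota> l3)"
    "tangent ?K X (Some (l3, i)) \<iota> = X l (\<iota> l) * of_bool (\<iota> l3 = i) * X l2 (\<iota> l2)" for X \<iota> i
    unfolding tangent_insert(1,2)[OF finK] tangent_insert(3)[OF finK in_K(1)]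
      tangent_insert(3)[OF finK in_K(2)] tK by simp_all
  have dirsK: "dirs K N (\<lambda>_. s) = insert None ((\<lambda>i. Some (l2, i)) ` ({1..N l2} - {s}) \<union> (\<lambda>j. Some (l3, j)) ` ({1..N l3} - {s}))" for s
    by (auto simp: dirs_def K_def image_iff)
  have "indep_on ?I ?S ?v"
  proof (rule indep_onI)
    fix c j0
    assume c0: "\<And>\<iota>. \<iota> \<in> ?I \<Longrightarrow> (\<Sum>j\<in>?S. c j * ?v j \<iota>) = 0" and j0: "j0 \<in> ?S"
    \<comment> \<open>Since \<open>\<tau>\<close> is injective, at most one foreign point
      contributes to \<open>\<gamma> b y\<close>, so its coefficient can be recovered at the
      end.\<close>
    define \<gamma> where "\<gamma> b y = (\<Sum>p\<in>?P2. of_bool (y = \<tau> p) * c (p, Some (l, 2 * g + b)))" for b y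
    let ?D = "\<lambda>s. c (pt s, None)"
    let ?E = "\<lambda>s. c (pt s, Some (l, 2 * g + 2))"
    let ?B = "\<lambda>s i. c (pt s, Some (l2, i))"
    let ?C = "\<lambda>s j. c (pt s, Some (l3, j))"
    have eq: "\<forall>b\<in>{1, 2}. \<forall>i\<in>{1..N l2}. \<forall>j\<in>{1..N l3}.
      (if j \<le> 2 * q \<and> i \<noteq> j then A b j * ?B j i else 0) +
      (if i \<le> 2 * q \<and> i \<noteq> j then A b i * ?C i j else 0) +
      (if i = j \<and> i \<le> 2 * q then A b i * ?D i + (if b = 2 then ?E i else 0) else 0) +
      \<gamma> b (pair_top q i, pair_top q j) = 0"
    proof (intro ballI)
      fix b i j :: nat assume b: "b \<in> {1, 2}" and i: "i \<in> {1..N l2}" and j: "j \<in> {1..N l3}"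
      define \<iota> where "\<iota> = (\<lambda>k. if k = l then 2 * g + b else if k = l2 then i
        else if k = l3 then j else undefined)"
      have \<iota>: "\<iota> l = 2 * g + b" "\<iota> l2 = i" "\<iota> l3 = j"
        using distinct by (auto simp: \<iota>_def)
      have "2 * g + b \<in> {1..N l}" using b g Nl by auto
      then have "\<forall>k\<in>{l, l2, l3}. \<iota> k \<in> {1..N k}" using \<iota> i j by simp
      moreover have "\<iota> k = undefined" if "k \<notin> {l, l2, l3}" for k
        using that by (simp add: \<iota>_def)
      ultimately have "\<iota> \<in> multi_indices ?K N"
        unfolding multi_indices_def K_def by (intro PiE_I) blast+
      moreover have "\<iota> l \<in> {2 * g + 1, 2 * g + 2}" using b \<iota>(1) by auto
      ultimately have \<iota>I: "\<iota> \<in> ?I" by blast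
      let ?F = "\<lambda>p. \<Sum>\<delta>\<in>(if p div Q = g then insert (Some (l, 2 * g + 2)) (dirs K N (\<lambda>_. p mod Q + 1))
        else {Some (l, 2 * g + 1), Some (l, 2 * g + 2)}). c (p, \<delta>) * tangent ?K (?X p) \<delta> \<iota>"
      have "sum ?F ?P = (\<Sum>(p, \<delta>)\<in>?S. c (p, \<delta>) * tangent ?K (?X p) \<delta> \<iota>)"
        by (rule sum.Sigma) (use finK in auto)
      also have "\<dots> = (\<Sum>j\<in>?S. c j * ?v j \<iota>)"
        by (rule sum.cong[OF refl]) (simp only: case_prod_beta prod.collapse)
      also have "\<dots> = 0" by (rule c0[OF \<iota>I])
      finally have "0 = sum ?F ?P" by (rule sym)
      also have "sum ?F ?P = sum ?F (?P1 \<union> ?P2)" by (rule sum.cong) auto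
      also have "\<dots> = sum ?F ?P1 + sum ?F ?P2" by (rule sum.union_disjoint) auto
      also have "sum ?F ?P2 = \<gamma> b (pair_top q i, pair_top q j)"
        unfolding \<gamma>_def
      proof (rule sum.cong[OF refl])
        fix p assume p: "p \<in> ?P2"
        then have "?F p = c (p, Some (l, 2 * g + 1)) * tangent ?K (?X p) (Some (l, 2 * g + 1)) \<iota> +
            c (p, Some (l, 2 * g + 2)) * tangent ?K (?X p) (Some (l, 2 * g + 2)) \<iota>"
          by simp
        also have "\<dots> = of_bool ((pair_top q i, pair_top q j) = \<tau> p) * c (p, Some (l, 2 * g + b))"
        proof -
          have "p div Q \<noteq> g" using p by simp
          then have x: "x (p, l2, i) = of_bool (pair_top q i = fst (\<tau> p))"
            "x (p, l3, j) = of_bool (pair_top q j = snd (\<tau> p))"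
            using distinct by (auto simp: x_def)
          have "of_bool ((pair_top q i, pair_top q j) = \<tau> p) = x (p, l2, i) * x (p, l3, j)"
            unfolding x by (cases "\<tau> p") simp
          then show ?thesis
            using b distinct unfolding t \<iota> by (elim insertE emptyE) simp_all
        qed
        finally show "?F p = of_bool ((pair_top q i, pair_top q j) = \<tau> p) * c (p, Some (l, 2 * g + b))" .
      qed
      also have "sum ?F ?P1 = (\<Sum>s\<in>{1..Q}. ?F (pt s))"
        by (rule sum.reindex_bij_betw[OF bij, symmetric])
      \<comment> \<open>With unit vectors as factors, the entry (i, j) meets only point j along its
        directions in mode \<open>l2\<close>, point i along its directions in mode
        \<open>l3\<close>, and on the diagonal point i through \<open>None\<close> and its
        mode-\<open>l\<close> direction.\<close>
      also have "\<dots> = (\<Sum>s\<in>{1..Q}.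
          (if s = j then if i \<noteq> j then A b j * ?B j i else 0 else 0) +
          (if s = i then if i \<noteq> j then A b i * ?C i j else 0 else 0) +
          (if s = i then if i = j then A b i * ?D i + (if b = 2 then ?E i else 0) else 0 else 0))"
      proof (rule sum.cong[OF refl])
        fix s assume s: "s \<in> {1..Q}"
        let ?p = "pt s"
        have \<alpha>: "\<alpha> ?p (2 * g + b) = A b s"
          using pt_div[OF s] b by (auto simp: \<alpha>_def A_def)
        have x: "x (?p, k, i') = of_bool (i' = s)" for k i'
          using pt_div[OF s] by (simp add: x_def)
        let ?f = "\<lambda>\<delta>. c (?p, \<delta>) * tangent ?K (?X ?p) \<delta> \<iota>"
        have "?F ?p = sum ?f (insert (Some (l, 2 * g + 2)) (insert None
            ((\<lambda>i. Some (l2, i)) ` ({1..N l2} - {s}) \<union> (\<lambda>j. Some (l3, j)) ` ({1..N l3} - {s}))))"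
          using pt_div[OF s] by (simp add: dirsK)
        also have "\<dots> = ?f (Some (l, 2 * g + 2)) + (?f None +
            sum ?f ((\<lambda>i. Some (l2, i)) ` ({1..N l2} - {s}) \<union> (\<lambda>j. Some (l3, j)) ` ({1..N l3} - {s})))"
          using distinct by (subst sum.insert; (subst sum.insert)?) auto
        also have "sum ?f ((\<lambda>i. Some (l2, i)) ` ({1..N l2} - {s}) \<union> (\<lambda>j. Some (l3, j)) ` ({1..N l3} - {s})) =
            (\<Sum>i'\<in>{1..N l2} - {s}. ?f (Some (l2, i'))) + (\<Sum>j'\<in>{1..N l3} - {s}. ?f (Some (l3, j')))"
          using distinct by (subst sum.union_disjoint) (auto simp: sum.reindex inj_on_def)
        also have "(\<Sum>i'\<in>{1..N l2} - {s}. ?f (Some (l2, i'))) =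
            (\<Sum>i'\<in>{1..N l2} - {s}. if i' = i then ?B s i * A b s * of_bool (j = s) else 0)"
          using distinct unfolding t \<iota> by (intro sum.cong refl) (auto simp: x \<alpha>)
        also have "\<dots> = (if s = j then if i \<noteq> j then A b j * ?B j i else 0 else 0)"
          using i by (auto simp: sum.delta)
        also have "(\<Sum>j'\<in>{1..N l3} - {s}. ?f (Some (l3, j'))) =
            (\<Sum>j'\<in>{1..N l3} - {s}. if j' = j then ?C s j * A b s * of_bool (i = s) else 0)"
          using distinct unfolding t \<iota> by (intro sum.cong refl) (auto simp: x \<alpha>)
        also have "\<dots> = (if s = i then if i \<noteq> j then A b i * ?C i j else 0 else 0)"
          using j by (auto simp: sum.delta)
        also have "?f (Some (l, 2 * g + 2)) = (if s = i \<and> i = j \<and> b = 2 then ?E i else 0)"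
          using distinct unfolding t \<iota> by (auto simp: x)
        also have "?f None = (if s = i \<and> i = j then A b i * ?D i else 0)"
          using distinct unfolding t \<iota> by (auto simp: x \<alpha>)
        finally show "?F ?p = (if s = j then if i \<noteq> j then A b j * ?B j i else 0 else 0) +
          (if s = i then if i \<noteq> j then A b i * ?C i j else 0 else 0) +
          (if s = i then if i = j then A b i * ?D i + (if b = 2 then ?E i else 0) else 0 else 0)"
          by auto
      qed
      also have "\<dots> = (if j \<le> 2 * q \<and> i \<noteq> j then A b j * ?B j i else 0) +
          (if i \<le> 2 * q \<and> i \<noteq> j then A b i * ?C i j else 0) +
          (if i = j \<and> i \<le> 2 * q then A b i * ?D i + (if b = 2 then ?E i else 0) else 0)"
      proof -
        have delta: "(\<Sum>s\<in>{1..Q}. if s = k then y else 0) = (if k \<le> 2 * q then y else 0)"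
          if "k \<ge> 1" for k and y :: real
          using that by (simp add: Q_def)
        have "i \<ge> 1" "j \<ge> 1" using i j by auto
        then show ?thesis unfolding sum.distrib
          by (simp only: delta) (cases "i = j"; cases "i \<le> 2 * q"; cases "j \<le> 2 * q"; simp)
      qed
      finally show "(if j \<le> 2 * q \<and> i \<noteq> j then A b j * ?B j i else 0) +
        (if i \<le> 2 * q \<and> i \<noteq> j then A b i * ?C i j else 0) +
        (if i = j \<and> i \<le> 2 * q then A b i * ?D i + (if b = 2 then ?E i else 0) else 0) +
        \<gamma> b (pair_top q i, pair_top q j) = 0"
        by (simp only:)
    qed
    have \<gamma>0: "\<forall>b. \<forall>i\<le>2 * q. \<forall>j\<le>2 * q. \<gamma> b (i, j) = 0"
      unfolding \<gamma>_def
    proof (intro allI impI sum.neutral ballI)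
      fix b i j p :: nat assume ij: "i \<le> 2 * q" "j \<le> 2 * q" and p: "p \<in> ?P2"
      from \<tau>T[OF p] have "\<tau> p \<noteq> (i, j)" using ij by auto
      then show "of_bool ((i, j) = \<tau> p) * c (p, Some (l, 2 * g + b)) = 0" by auto
    qed
    have A: "A 1 s = 1" "A 2 s = real s" for s by (simp_all add: A_def)
    note solved = pencil_relation_trivial[where A = A and B = ?B and C = ?C and D = ?D and E = ?E
        and \<gamma> = \<gamma>, OF A N23[unfolded Q_def] \<gamma>0 eq]
    obtain p \<delta> where p: "j0 = (p, \<delta>)" "p \<in> ?P" using j0 by auto
    show "c j0 = 0"
    proof (cases "p div Q = g")
      case True
      have "p \<in> ?P1" using True p by auto
      then have "p \<in> pt ` {1..Q}" using bij by (simp add: bij_betw_def)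
      then obtain s where s: "s \<in> {1..Q}" "p = pt s" by blast
      have "\<delta> \<in> insert (Some (l, 2 * g + 2)) (dirs K N (\<lambda>_. s))"
        using j0 p True pt_div[OF s(1)] s(2) by auto
      moreover have s': "s \<in> {1..2 * q}" using s by (simp add: Q_def)
      have "\<forall>i\<in>{1..N l2} - {s}. c (pt s, Some (l2, i)) = 0"
        "\<forall>j\<in>{1..N l3} - {s}. c (pt s, Some (l3, j)) = 0"
        using solved(3,4)[OF s'] by blast+
      ultimately show ?thesis using solved(1,2)[OF s'] s(2) p(1) unfolding dirsK by blast
    next
      case False
      then obtain b where b: "b \<in> {1, 2}" "\<delta> = Some (l, 2 * g + b)"
        using j0 p by auto
      have p2: "p \<in> ?P2" using False p by auto
      have T: "\<tau> p \<in> ?T" by (rule \<tau>T[OF p2])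
      obtain i j where ij: "\<tau> p = (i, j)" by fastforce
      have "\<gamma> b (i, j) = (\<Sum>p'\<in>?P2. if p' = p then c (p', Some (l, 2 * g + b)) else 0)"
        unfolding \<gamma>_def ij[symmetric]
      proof (rule sum.cong[OF refl])
        fix p' assume "p' \<in> ?P2"
        then have "\<tau> p = \<tau> p' \<longleftrightarrow> p' = p"
          using inj_on_eq_iff[OF \<tau>(2) p2] by metis
        then show "of_bool (\<tau> p = \<tau> p') * c (p', Some (l, 2 * g + b)) =
            (if p' = p then c (p', Some (l, 2 * g + b)) else 0)" by simp
      qed
      also have "\<dots> = c j0" using p2 p(1) b(2) by (simp only: sum.delta) simp
      finally have "c j0 = \<gamma> b (i, j)" by (rule sym)
      moreover have "i \<in> {1..N l2}" "j \<in> {1..N l3}" "pair_top q i = i" "pair_top q j = j"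
        using T unfolding ij by simp_all
      ultimately show ?thesis using solved(5)[OF b(1), of i j] by simp
    qed
  qed
  then show ?thesis by blast
qed

lemma nondefective_0 [simp]: "nondefective K N 0"
  by (auto simp: nondefective_def tangent_indep_def)

lemma nondefective_base:
  fixes l l2 l3 :: nat and N :: "nat \<Rightarrow> nat"
  assumes distinct: "l \<noteq> l2" "l \<noteq> l3" "l2 \<noteq> l3"
    and Nl: "2 * h \<le> N l" and N23: "2 * q \<le> N l2" "2 * q \<le> N l3"
    and count: "(h - 1) * (2 * q) + q * (N l2 + N l3) \<le> N l2 * N l3"
  shows "nondefective {l, l2, l3} N (2 * h * q)"
proof (cases "h = 0 \<or> q = 0")
  case True
  then show ?thesis by auto
next
  case False
  define Q where "Q = 2 * q"
  define K where "K = {l2, l3}"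
  define \<alpha> where "\<alpha> p i = (if i = 2 * (p div Q) + 1 then 1
      else if i = 2 * (p div Q) + 2 then real (p mod Q + 1) else (0 :: real))" for p i
  let ?P = "{..<h * Q}"
  let ?K = "insert l K"
  have finK: "finite K" "l \<notin> K" using distinct by (auto simp: K_def)
  let ?X = "\<lambda>x p k i. if k = l then \<alpha> p i else x (p, k, i)"
  let ?I = "\<lambda>g. {\<iota> \<in> multi_indices ?K N. \<iota> l \<in> {2 * g + 1, 2 * g + 2}}"
  let ?S = "\<lambda>g. SIGMA p:?P. if p div Q = g then insert (Some (l, 2 * g + 2)) (dirs K N (\<lambda>_. p mod Q + 1))
       else {Some (l, 2 * g + 1), Some (l, 2 * g + 2)}"
  define C where "C g x \<longleftrightarrow> indep_on (?I g) (?S g) (\<lambda>(p, \<delta>). tangent ?K (?X x p) \<delta>)"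
    for g and x :: "nat \<times> nat \<times> nat \<Rightarrow> real"
  have finS: "finite (?S g)" for g using finK by auto
  have "\<exists>x. \<forall>g\<in>{..<h}. C g x"
  proof (rule generic_common_point)
    have "polyfun (\<lambda>t. if k = l then \<alpha> p i else (1 - t) * x (p, k, i) + t * y (p, k, i))"
      for x y :: "nat \<times> nat \<times> nat \<Rightarrow> real" and p k i
      by (cases "k = l") (auto intro!: polyfun_add polyfun_mult polyfun_diff)
    then show "generic (C g)" for g
      unfolding C_def using finS by (intro tangent_generic) auto
    show "\<exists>x. C g x" if "g \<in> {..<h}" for g
      unfolding C_def \<alpha>_def Q_def K_def
      by (rule pencil_block_indep) (use that distinct Nl N23 count in auto)
  qed simp
  then obtain x where x: "\<And>g. g < h \<Longrightarrow> C g x" by auto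
  define x' where "x' = (\<lambda>(p, k, i). if k = l then \<alpha> p i else x (p, k, i))"
  define i0 where "i0 p k = (if k = l then 2 * (p div Q) + 1 else p mod Q + 1)" for p k
  have dirsK: "dirs K N (i0 p) = dirs K N (\<lambda>_. p mod Q + 1)" for p
    using finK(2) unfolding dirs_def i0_def by (intro arg_cong[where f = "insert None"]) (auto simp: image_iff)
  let ?J = "SIGMA p:?P. dirs ?K N (i0 p)"
  let ?v = "\<lambda>(p, \<delta>). tangent ?K (\<lambda>k i. x' (p, k, i)) \<delta>"
  have x'l: "x' (p, l, i) = \<alpha> p i" for p i by (simp add: x'_def)
  have div: "p div Q < h" "p mod Q < Q" if "p \<in> ?P" for p
    using that False by (auto simp: Q_def less_mult_imp_div_less)
  have block: "indep_on (?I g) (?S g) ?v" if "g < h" for g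
  proof -
    have "(\<lambda>k i. x' (p, k, i)) = ?X x p" for p
      by (auto simp: x'_def fun_eq_iff)
    then show ?thesis using x[OF that] by (simp only: C_def)
  qed
  text \<open>Slices beyond the blocks only see the rank-one tensors of the remaining modes.\<close>
  have slice: "indep_on {\<iota> \<in> multi_indices ?K N. \<iota> l = i} (?P \<times> {Some (l, i)}) ?v" if i: "i \<in> {1..N l}" for i
  proof (rule indep_onI)
    fix c j
    assume c: "\<And>\<iota>. \<iota> \<in> {\<iota> \<in> multi_indices ?K N. \<iota> l = i} \<Longrightarrow> (\<Sum>j\<in>?P \<times> {Some (l, i)}. c j * ?v j \<iota>) = 0"
      and j: "j \<in> ?P \<times> {Some (l, i)}"
    \<comment> \<open>Every point has the direction \<open>Some (l, 2)\<close> in block 0, own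
      points because row 1 is the omitted one. Slice 2 of that block thus already carries any
      relation among the rank-one matrices of all points.\<close>
    define d :: "nat \<times> (nat \<times> nat) option \<Rightarrow> real" where
      "d = (\<lambda>(p, \<delta>). if \<delta> = Some (l, 2) then c (p, Some (l, i)) else 0)"
    have indep: "indep_on (?I 0) (?S 0) ?v" using block False by blast
    have zero: "(\<Sum>j\<in>?S 0. d j * ?v j \<iota>) = 0" if \<iota>: "\<iota> \<in> ?I 0" for \<iota>
    proof -
      have "(\<Sum>j\<in>?S 0. d j * ?v j \<iota>) = (\<Sum>j\<in>(\<lambda>p. (p, Some (l, 2))) ` ?P. d j * ?v j \<iota>)"
        using finS[of 0] by (intro sum.mono_neutral_right) (auto simp: d_def split: if_splits)
      also have "\<dots> = (\<Sum>p\<in>?P. c (p, Some (l, i)) * tangent ?K (\<lambda>k i. x' (p, k, i)) (Some (l, 2)) \<iota>)"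
        by (subst sum.reindex) (auto simp: inj_on_def d_def)
      also have "\<dots> = of_bool (\<iota> l = 2) *
          (\<Sum>p\<in>?P. c (p, Some (l, i)) * tangent K (\<lambda>k i. x' (p, k, i)) None \<iota>)"
        unfolding tangent_insert(2)[OF finK] sum_distrib_left by (intro sum.cong) auto
      also have "(\<Sum>p\<in>?P. c (p, Some (l, i)) * tangent K (\<lambda>k i. x' (p, k, i)) None \<iota>) =
          (\<Sum>j\<in>?P \<times> {Some (l, i)}. c j * ?v j (\<iota>(l := i)))"
      proof -
        have "?P \<times> {Some (l, i)} = (\<lambda>p. (p, Some (l, i))) ` ?P" by auto
        moreover have "tangent K (\<lambda>k i. x' (p, k, i)) None (\<iota>(l := i)) = tangent K (\<lambda>k i. x' (p, k, i)) None \<iota>" for p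
          using finK(2) by (intro tangent_cong[where N = N and ?i0.0 = "i0 p"]) auto
        ultimately show ?thesis
          by (simp add: sum.reindex inj_on_def tangent_insert(2)[OF finK] del: tangent.simps)
      qed
      also have "\<dots> = 0"
      proof (rule c)
        have "\<iota>(l := i) \<in> multi_indices (insert l ?K) N"
          using \<iota> i by (intro multi_indices_insert_upd) auto
        then show "\<iota>(l := i) \<in> {\<iota> \<in> multi_indices ?K N. \<iota> l = i}" by simp
      qed
      finally show ?thesis by simp
    qed
    obtain p where p: "j = (p, Some (l, i))" "p \<in> ?P" using j by auto
    then have "(p, Some (l, 2)) \<in> ?S 0" by simp
    from indep_onD[OF indep zero this] show "c j = 0" using p by (simp add: d_def)
  qed
  have dirs_insert: "\<delta> \<in> dirs K N (i0 p) \<or> (\<exists>i. \<delta> = Some (l, i) \<and> i \<in> {1..N l} \<and> i \<noteq> 2 * (p div Q) + 1)"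
    if "\<delta> \<in> dirs ?K N (i0 p)" for \<delta> p
    using that by (auto simp: dirs_def i0_def)
  have \<alpha>0: "\<alpha> p i = 0" if "i \<notin> {2 * (p div Q) + 1, 2 * (p div Q) + 2}" for p i
    using that by (simp add: \<alpha>_def)
  have tangent0: "tangent ?K (\<lambda>k i. x' (p, k, i)) \<delta> \<iota> = 0"
    if \<delta>: "\<delta> \<in> dirs K N (i0 p)" and "\<iota> l \<notin> {2 * (p div Q) + 1, 2 * (p div Q) + 2}" for p \<delta> \<iota>
  proof (cases \<delta>)
    case None
    then show ?thesis using \<alpha>0[OF that(2)] by (simp add: tangent_insert(1)[OF finK] x'l del: tangent.simps)
  next
    case (Some d)
    then obtain k i where "\<delta> = Some (k, i)" "k \<in> K" using \<delta> by (auto simp: dirs_def)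
    then show ?thesis using \<alpha>0[OF that(2)]
      by (simp add: tangent_insert(3)[OF finK] x'l del: tangent.simps)
  qed
  have parity: "2 * a + 2 \<noteq> 2 * b + 1" for a b :: nat by presburger
  have blocks_disjoint: "i \<notin> {2 * b + 1, 2 * b + 2}" if "i \<in> {2 * a + 1, 2 * a + 2}" "b \<noteq> a"
    for a b i :: nat
    using that by (auto; presburger)
  \<comment> \<open>An index below h names a block, an index from \<open>2 * h + 1\<close> on a
    single slice; the two ranges do not meet, so one kind of index serves both.\<close>
  let ?S' = "\<lambda>g. if g < h then ?S g else ?P \<times> {Some (l, g)}"
  let ?I' = "\<lambda>g. if g < h then ?I g else {\<iota> \<in> multi_indices ?K N. \<iota> l = g}"
  have "tangent_indep ?K N ?P x' i0"
    unfolding tangent_indep_def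
  proof (rule indep_on_slices[where G = "{..<h} \<union> {2 * h + 1..N l}" and S = ?S' and I' = ?I'])
    fix j assume j: "j \<in> ?J"
    obtain p \<delta> where p: "j = (p, \<delta>)" "p \<in> ?P" "\<delta> \<in> dirs ?K N (i0 p)" using j by auto
    from dirs_insert[OF p(3)] show "\<exists>g\<in>{..<h} \<union> {2 * h + 1..N l}. j \<in> ?S' g"
    proof
      assume "\<delta> \<in> dirs K N (i0 p)"
      then show ?thesis using p div by (intro bexI[of _ "p div Q"]) (auto simp: dirsK)
    next
      assume "\<exists>i. \<delta> = Some (l, i) \<and> i \<in> {1..N l} \<and> i \<noteq> 2 * (p div Q) + 1"
      then obtain i where i: "\<delta> = Some (l, i)" "i \<in> {1..N l}" "i \<noteq> 2 * (p div Q) + 1" by blast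
      show ?thesis
      proof (cases "i \<le> 2 * h")
        case True
        let ?g = "(i - 1) div 2"
        have g: "?g < h" "i = 2 * ?g + 1 \<or> i = 2 * ?g + 2" using True i(2) by (auto; presburger)+
        then have "\<delta> \<in> (if p div Q = ?g then insert (Some (l, 2 * ?g + 2)) (dirs K N (\<lambda>_. p mod Q + 1))
          else {Some (l, 2 * ?g + 1), Some (l, 2 * ?g + 2)})"
          using i by (cases "p div Q = ?g") auto
        then show ?thesis using p g by (intro bexI[of _ ?g]) auto
      next
        case False
        then show ?thesis using p i by (intro bexI[of _ i]) auto
      qed
    qed
  next
    fix g assume g: "g \<in> {..<h} \<union> {2 * h + 1..N l}"
    show "?S' g \<subseteq> ?J"
    proof
      fix j assume j: "j \<in> ?S' g"
      obtain p \<delta> where p: "j = (p, \<delta>)" "p \<in> ?P" using j by (auto split: if_splits)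
      have sub: "dirs K N (i0 p) \<subseteq> dirs ?K N (i0 p)" by (rule dirs_mono) auto
      have "\<delta> \<in> dirs ?K N (i0 p)"
      proof (cases "g < h")
        case True
        then have "2 * g + 1 \<in> {1..N l}" "2 * g + 2 \<in> {1..N l}" using Nl by auto
        moreover have "2 * g + 2 \<noteq> 2 * (p div Q) + 1" by (rule parity)
        moreover have "i0 p l = 2 * (p div Q) + 1" by (simp add: i0_def)
        ultimately show ?thesis using j p True sub unfolding dirsK[symmetric]
          by (cases "p div Q = g") auto
      next
        case False
        then have "\<delta> = Some (l, g)" "g \<in> {1..N l}" "g \<ge> 2 * h + 1" using j p g by auto
        moreover have "i0 p l = 2 * (p div Q) + 1" by (simp add: i0_def)
        ultimately show ?thesis using div(1)[OF p(2)] by auto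
      qed
      then show "j \<in> ?J" using p by auto
    qed
  next
    fix g j \<iota> assume g: "g \<in> {..<h} \<union> {2 * h + 1..N l}" "\<iota> \<in> ?I' g" "j \<in> ?J" "j \<notin> ?S' g"
    then obtain p \<delta> where p: "j = (p, \<delta>)" "p \<in> ?P" "\<delta> \<in> dirs ?K N (i0 p)" by auto
    have "tangent ?K (\<lambda>k i. x' (p, k, i)) \<delta> \<iota> = 0"
    proof (cases "g < h")
      case True
      then have \<iota>l: "\<iota> l \<in> {2 * g + 1, 2 * g + 2}" using g(2) by simp
      have ns: "\<delta> \<notin> (if p div Q = g then insert (Some (l, 2 * g + 2)) (dirs K N (i0 p))
          else {Some (l, 2 * g + 1), Some (l, 2 * g + 2)})"
        using g(4) p True unfolding dirsK by (simp only: if_True mem_Sigma_iff simp_thms)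
      from dirs_insert[OF p(3)] show ?thesis
      proof
        assume *: "\<delta> \<in> dirs K N (i0 p)"
        then have "p div Q \<noteq> g" using ns by auto
        then have "\<iota> l \<notin> {2 * (p div Q) + 1, 2 * (p div Q) + 2}" by (rule blocks_disjoint[OF \<iota>l])
        then show ?thesis using tangent0[OF *] by blast
      next
        assume "\<exists>i. \<delta> = Some (l, i) \<and> i \<in> {1..N l} \<and> i \<noteq> 2 * (p div Q) + 1"
        then obtain i where i: "\<delta> = Some (l, i)" "i \<noteq> 2 * (p div Q) + 1" by blast
        then have "i \<noteq> \<iota> l" using ns \<iota>l by (auto split: if_splits)
        then show ?thesis using i by (simp add: tangent_insert(2)[OF finK] del: tangent.simps)
      qed
    next
      case False
      then have \<iota>l: "\<iota> l = g" "g \<ge> 2 * h + 1" using g by auto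
      from dirs_insert[OF p(3)] show ?thesis
      proof
        assume *: "\<delta> \<in> dirs K N (i0 p)"
        have "\<iota> l \<notin> {2 * (p div Q) + 1, 2 * (p div Q) + 2}" using \<iota>l div(1)[OF p(2)] by auto
        then show ?thesis using tangent0[OF *] by blast
      next
        assume "\<exists>i. \<delta> = Some (l, i) \<and> i \<in> {1..N l} \<and> i \<noteq> 2 * (p div Q) + 1"
        then obtain i where i: "\<delta> = Some (l, i)" by blast
        then have "i \<noteq> \<iota> l" using g(4) p False \<iota>l by auto
        then show ?thesis using i by (simp add: tangent_insert(2)[OF finK] del: tangent.simps)
      qed
    qed
    then show "?v j \<iota> = 0" using p by simp
  next
    fix g assume g: "g \<in> {..<h} \<union> {2 * h + 1..N l}"
    show "?I' g \<subseteq> multi_indices ?K N" by auto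
    show "indep_on (?I' g) (?S' g) ?v"
      using block slice[of g] g by (cases "g < h") auto
  qed (use finK in auto)
  moreover have "i0 p k \<in> {1..N k}" if "p < h * Q" "k \<in> ?K" for p k
  proof -
    have "p div Q < h" "p mod Q < Q" using div[of p] that(1) by auto
    then show ?thesis using that(2) Nl N23 by (auto simp: i0_def K_def Q_def)
  qed
  ultimately have "nondefective ?K N (h * Q)" unfolding nondefective_def by blast
  then show ?thesis by (simp add: K_def Q_def mult_ac)
qed

text \<open>Induction over the trailing modes. The tensor keeps its original sizes: the trimmed ones
  only provide the count, which survives when the last two sizes grow back. If the first of the
  three sizes is odd, one slice remains outside the blocks.\<close>

lemma nondefective_rank_bound:
  assumes "m \<ge> 3" "\<And>i. i \<in> {1..m} \<Longrightarrow> N i \<ge> 1"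
    and "3 \<le> k" "k \<le> m"
  shows "nondefective {m - k + 1..m} N (rank_bound m N k)"
  using assms(3,4)
proof (induction k rule: dec_induct)
  case base
  define a where "a = 2 * (N (m - 2) div 2)"
  define b where "b = min (N (m - 1)) a"
  define c where "c = min (N m) b"
  define q where "q = b * c div (a + b + c - 2)"
  have "trimmed_sizes (N (m - 2)) (N (m - 1)) (N m) = (a, b, c)"
    by (simp add: trimmed_sizes_eq Let_def a_def b_def c_def)
  then have "rank_bound m N 3 = a * q" by (simp add: rank_bound.simps[of m N 3] q_def)
  then have bound: "rank_bound m N 3 = 2 * (N (m - 2) div 2) * q" by (simp add: a_def)
  have modes: "{m - 3 + 1..m} = {m - 2, m - 1, m}" using assms(1) by auto
  show ?case
  proof (cases "a = 0 \<or> q = 0")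
    case True
    then have "rank_bound m N 3 = 0" using bound by (auto simp: a_def)
    then show ?thesis by simp
  next
    case False
    have le: "b \<le> a" "c \<le> b" "b \<le> N (m - 1)" "c \<le> N m" "a \<le> N (m - 2)"
      by (simp_all only: a_def[symmetric] b_def c_def min.cobounded1 min.cobounded2) (simp add: a_def)
    have a2: "a \<ge> 2" using False by (auto simp: a_def)
    have qle: "q * (a + b + c - 2) \<le> b * c"
      unfolding q_def by (rule div_times_less_eq_dividend)
    \<comment> \<open>For c = 0 the dividend is 0, and for c = 1 it is b < a + b - 1; either way q
      would vanish.\<close>
    have c2: "c \<ge> 2"
    proof (rule ccontr)
      assume "\<not> c \<ge> 2"
      then have "c = 0 \<or> c = 1" by linarith
      moreover have "b < a + b + 1 - 2" using a2 by linarith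
      ultimately have "q = 0" unfolding q_def by auto
      then show False using False by simp
    qed
    \<comment> \<open>Since b \<le> a and c \<ge> 2, the divisor is at least 2 b, whence 2 q \<le>
      c: the 2 q unit vectors of a block fit into both of the last modes.\<close>
    have "q * (2 * b) \<le> q * (a + b + c - 2)" using le c2 by (intro mult_left_mono) auto
    also note qle
    finally have "b * (2 * q) \<le> b * c" by (simp only: mult_ac)
    then have q2: "2 * q \<le> c" using c2 le by simp
    have count: "(N (m - 2) div 2 - 1) * (2 * q) + q * (N (m - 1) + N m) \<le> N (m - 1) * N m"
    proof -
      \<comment> \<open>Growing b to b + b' costs q b' on the left and gains at least c b' on the
        right; growing c to c + c' costs q c' and gains at least b c'.\<close>
      obtain b' c' where bc: "N (m - 1) = b + b'" "N m = c + c'" using le by (metis le_Suc_ex)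
      have "(N (m - 2) div 2 - 1) * (2 * q) = q * (a - 2)"
        by (simp add: a_def diff_mult_distrib2 diff_mult_distrib mult_ac)
      moreover have "q * (a - 2) + q * (b + c) \<le> b * c"
      proof -
        have "a - 2 + (b + c) = a + b + c - 2" using a2 by linarith
        then show ?thesis using qle by (simp only: distrib_left[symmetric])
      qed
      moreover have "q * b' \<le> c * b'" "q * c' \<le> b * c'" using q2 le by (auto intro!: mult_right_mono)
      moreover have "q * (b + b' + (c + c')) = q * (b + c) + q * b' + q * c'"
        "(b + b') * (c + c') = b * c + b * c' + c * b' + b' * c'"
        by (simp_all add: algebra_simps)
      ultimately show ?thesis unfolding bc by linarith
    qed
    have "nondefective {m - 2, m - 1, m} N (2 * (N (m - 2) div 2) * q)"
      using assms(1) le q2 count by (intro nondefective_base) auto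
    then show ?thesis unfolding modes bound .
  qed
next
  case (step k)
  let ?l = "m - Suc k + 1"
  let ?K = "{m - k + 1..m}"
  have l: "m - k = ?l" "?l \<in> {1..m}" using step by auto
  have K: "{?l..m} = insert ?l ?K" "?l \<notin> ?K" using step by auto
  define B where "B = (\<Prod>i\<in>?K. N i) div ((\<Sum>i\<in>{?l..m}. N i) - Suc k + 1)"
  define q where "q = min (rank_bound m N k) B"
  have bound: "rank_bound m N (Suc k) = N ?l * q"
  proof -
    have "m - Suc k + 2 = m - k + 1" using step by auto
    then show ?thesis using step.hyps by (simp add: rank_bound.simps[of m N "Suc k"] q_def B_def)
  qed
  have "nondefective ?K N q"
    using step by (intro nondefective_mono[OF step.IH]) (auto simp: q_def)
  moreover have "q * (1 + (\<Sum>i\<in>?K. N i - 1)) + (N ?l - 1) * q \<le> (\<Prod>i\<in>?K. N i)"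
  proof -
    have N1: "N i \<ge> 1" if "i \<in> ?K" for i using that by (intro assms(2)) auto
    have "(\<Sum>i\<in>?K. N i) = (\<Sum>i\<in>?K. (N i - 1) + 1)"
    proof (rule sum.cong[OF refl])
      fix i assume "i \<in> ?K"
      from N1[OF this] show "N i = N i - 1 + 1" by simp
    qed
    also have "\<dots> = (\<Sum>i\<in>?K. N i - 1) + card ?K" unfolding sum.distrib by simp
    also have "card ?K = k" using step by auto
    finally have s: "(\<Sum>i\<in>?K. N i) = (\<Sum>i\<in>?K. N i - 1) + k" .
    have "(\<Sum>i\<in>{?l..m}. N i) = N ?l + (\<Sum>i\<in>?K. N i)" using K by simp
    \<comment> \<open>All sizes are positive, so the truncated subtraction is exact and the divisor
      is the number of vectors per unit of q in a slice.\<close>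
    then have "(\<Sum>i\<in>{?l..m}. N i) - Suc k + 1 = (1 + (\<Sum>i\<in>?K. N i - 1)) + (N ?l - 1)"
      using s assms(2)[OF l(2)] by simp
    then have "q * (1 + (\<Sum>i\<in>?K. N i - 1)) + (N ?l - 1) * q = q * ((\<Sum>i\<in>{?l..m}. N i) - Suc k + 1)"
      by (simp only: distrib_left mult.commute)
    also have "\<dots> \<le> B * ((\<Sum>i\<in>{?l..m}. N i) - Suc k + 1)"
      by (intro mult_right_mono) (auto simp: q_def)
    also have "\<dots> \<le> (\<Prod>i\<in>?K. N i)" unfolding B_def by (rule div_times_less_eq_dividend)
    finally show ?thesis .
  qed
  ultimately show ?case unfolding bound K(1)
    using K(2) by (intro nondefective_step) auto
qed

section \<open>Null sets, Hessians and strong convexity\<close>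

text \<open>
  Swapping the order of integration, some dilation \<open>x \<mapsto> a + t (x - a)\<close> with \<open>t \<noteq> 0\<close> has a null
  preimage of \<open>S\<close>.
\<close>

lemma closed_ray_finite_null:
  fixes S :: "'a::euclidean_space set"
  assumes "closed S" "\<And>x. finite {t. a + t *\<^sub>R (x - a) \<in> S}"
  shows "S \<in> null_sets lebesgue"
proof -
  let ?f = "\<lambda>p::real \<times> 'a. a + fst p *\<^sub>R (snd p - a)"
  \<comment> \<open>Closedness of S gives the joint measurability that the swap of the two
    almost-everywhere quantifiers requires.\<close>
  have "open (?f -` (- S))"
    using assms(1) by (intro open_vimage) (auto intro!: continuous_intros)
  then have "{p. ?f p \<notin> S} \<in> sets (borel :: (real \<times> 'a) measure)"
    by (auto simp: vimage_def)
  then have meas: "{p \<in> space (lborel \<Otimes>\<^sub>M lborel). a + fst p *\<^sub>R (snd p - a) \<notin> S} \<in> sets (lborel \<Otimes>\<^sub>M (lborel :: 'a measure))"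
    unfolding lborel_prod by simp
  have "AE x in lborel. AE t in lborel. a + t *\<^sub>R (x - a) \<notin> S"
  proof (rule AE_I2)
    fix x :: 'a
    have "{t. a + t *\<^sub>R (x - a) \<in> S} \<in> null_sets lborel"
      using assms(2) by (intro finite_imp_null_set_lborel)
    then show "AE t in lborel. a + t *\<^sub>R (x - a) \<notin> S"
      by (rule AE_I') auto
  qed
  then have "AE t in lborel. AE x in lborel. a + t *\<^sub>R (x - a) \<notin> S"
    by (subst lborel_pair.AE_commute[where P = "\<lambda>t x. a + t *\<^sub>R (x - a) \<notin> S", OF meas])
  then have ae: "AE t in lborel. t \<noteq> (0::real) \<and> (AE x in lborel. a + t *\<^sub>R (x - a) \<notin> S)"
    using AE_lborel_singleton[of "0::real"] by eventually_elim auto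
  have "\<exists>t::real. t \<noteq> 0 \<and> (AE x in lborel. a + t *\<^sub>R (x - a) \<notin> S)"
  proof (rule ccontr)
    assume no: "\<not> ?thesis"
    have "AE t in (lborel :: real measure). False"
      using ae by (rule eventually_mono) (use no in blast)
    then have "emeasure (lborel :: real measure) UNIV = 0"
      using AE_iff_measurable[of UNIV lborel "\<lambda>_::real. False"] by simp
    then show False by simp
  qed
  then obtain t :: real where t: "t \<noteq> 0" "AE x in lborel. a + t *\<^sub>R (x - a) \<notin> S" by blast
  then have "AE x in lebesgue. a + t *\<^sub>R (x - a) \<notin> S" by (simp add: AE_completion)
  then obtain Z where "Z \<in> null_sets lebesgue" "{x. a + t *\<^sub>R (x - a) \<in> S} \<subseteq> Z"
    by (auto simp: eventually_ae_filter)
  then have neg: "negligible {x. a + t *\<^sub>R (x - a) \<in> S}"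
    using negligible_subset negligible_iff_null_sets by blast
  have "negligible ((\<lambda>x. a + t *\<^sub>R (x - a)) ` {x. a + t *\<^sub>R (x - a) \<in> S})"
    by (rule negligible_differentiable_image_negligible[OF order_refl neg])
      (auto intro!: derivative_intros)
  moreover have "S \<subseteq> (\<lambda>x. a + t *\<^sub>R (x - a)) ` {x. a + t *\<^sub>R (x - a) \<in> S}"
  proof
    fix y assume y: "y \<in> S"
    have "a + t *\<^sub>R ((a + (1 / t) *\<^sub>R (y - a)) - a) = y" using t(1) by simp
    then show "y \<in> (\<lambda>x. a + t *\<^sub>R (x - a)) ` {x. a + t *\<^sub>R (x - a) \<in> S}"
      using y by (intro image_eqI[of _ _ "a + (1 / t) *\<^sub>R (y - a)"]) auto
  qed
  ultimately show ?thesis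
    using negligible_subset negligible_iff_null_sets by blast
qed

text \<open>Gradient and Hessian travel as explicit functions through sums and products. Symmetry
  and continuity of the Hessian then hold by construction, without appeal to the symmetry of second
  derivatives.\<close>

definition C2_data :: "(real ^ 'd \<Rightarrow> real) \<Rightarrow> (real ^ 'd \<Rightarrow> real ^ 'd) \<Rightarrow> (real ^ 'd \<Rightarrow> real ^ 'd ^ 'd) \<Rightarrow> bool"
  where "C2_data f G H \<longleftrightarrow>
    (\<forall>x. (f has_derivative (\<lambda>h. G x \<bullet> h)) (at x) \<and> (G has_derivative (\<lambda>h. H x *v h)) (at x) \<and>
      transpose (H x) = H x) \<and> continuous_on UNIV H"

definition outer :: "real ^ 'd \<Rightarrow> real ^ 'd \<Rightarrow> real ^ 'd ^ 'd" where
  "outer a b = (\<chi> i j. a $ i * b $ j)"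

lemma outer_mult_vec: "outer a b *v h = (b \<bullet> h) *\<^sub>R a"
  by (simp add: outer_def matrix_vector_mult_def vec_eq_iff inner_vec_def sum_distrib_left sum_distrib_right mult_ac)

lemma transpose_outer: "transpose (outer a b) = outer b a"
  by (simp add: outer_def transpose_def vec_eq_iff)

lemma transpose_add: "transpose (A + B) = transpose A + transpose (B :: real ^ 'd ^ 'd)"
  by (simp add: transpose_def vec_eq_iff)

lemma transpose_scaleR: "transpose (c *\<^sub>R A) = c *\<^sub>R transpose (A :: real ^ 'd ^ 'd)"
  by (simp add: transpose_def vec_eq_iff)

lemma continuous_on_outer [continuous_intros]:
  "continuous_on S f \<Longrightarrow> continuous_on S g \<Longrightarrow> continuous_on S (\<lambda>x. outer (f x) (g x))"
  unfolding outer_def by (intro continuous_intros)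

lemma C2_data_const: "C2_data (\<lambda>x. c) (\<lambda>x. 0) (\<lambda>x. 0)"
  by (auto simp: C2_data_def transpose_def vec_eq_iff)

lemma C2_data_component:
  fixes i :: "'d::finite"
  shows "C2_data (\<lambda>x. x $ i) (\<lambda>x. axis i 1) (\<lambda>x. 0)"
proof -
  have "((\<lambda>x. x $ i) has_derivative (\<lambda>h. axis i 1 \<bullet> h)) (at x)" for x :: "real ^ 'd"
    by (simp add: inner_axis' bounded_linear_imp_has_derivative bounded_linear_vec_nth)
  then show ?thesis by (auto simp: C2_data_def transpose_def vec_eq_iff)
qed

lemma C2_data_add:
  assumes "C2_data f G H" "C2_data f' G' H'"
  shows "C2_data (\<lambda>x. f x + f' x) (\<lambda>x. G x + G' x) (\<lambda>x. H x + H' x)"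
proof -
  note d = assms[unfolded C2_data_def]
  have "((\<lambda>x. f x + f' x) has_derivative (\<lambda>h. (G x + G' x) \<bullet> h)) (at x)" for x
    unfolding inner_add_left using d by (intro has_derivative_add) blast+
  moreover have "((\<lambda>x. G x + G' x) has_derivative (\<lambda>h. (H x + H' x) *v h)) (at x)" for x
    unfolding matrix_vector_mult_add_rdistrib using d by (intro has_derivative_add) blast+
  moreover have "continuous_on UNIV (\<lambda>x. H x + H' x)" using d by (intro continuous_intros) auto
  moreover have "transpose (H x + H' x) = H x + H' x" for x using d by (simp add: transpose_add)
  ultimately show ?thesis unfolding C2_data_def by blast
qed

lemma C2_data_mult:
  assumes "C2_data f G H" "C2_data f' G' H'"
  shows "C2_data (\<lambda>x. f x * f' x) (\<lambda>x. f x *\<^sub>R G' x + f' x *\<^sub>R G x)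
    (\<lambda>x. f x *\<^sub>R H' x + f' x *\<^sub>R H x + (outer (G x) (G' x) + outer (G' x) (G x)))"
proof -
  note d = assms[unfolded C2_data_def]
  have f: "(f has_derivative (\<lambda>h. G x \<bullet> h)) (at x)" "(f' has_derivative (\<lambda>h. G' x \<bullet> h)) (at x)"
    and G: "(G has_derivative (\<lambda>h. H x *v h)) (at x)" "(G' has_derivative (\<lambda>h. H' x *v h)) (at x)"
    and H: "transpose (H x) = H x" "transpose (H' x) = H' x" for x
    using d by blast+
  have cont: "continuous_on UNIV f" "continuous_on UNIV f'" "continuous_on UNIV G" "continuous_on UNIV G'"
    using f G by (auto intro!: has_derivative_continuous_on)
  have "((\<lambda>x. f x * f' x) has_derivative (\<lambda>h. (f x *\<^sub>R G' x + f' x *\<^sub>R G x) \<bullet> h)) (at x)" for x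
    using has_derivative_mult[OF f] by (simp add: inner_add_left mult_ac)
  moreover have "((\<lambda>x. f x *\<^sub>R G' x + f' x *\<^sub>R G x) has_derivative
      (\<lambda>h. (f x *\<^sub>R H' x + f' x *\<^sub>R H x + (outer (G x) (G' x) + outer (G' x) (G x))) *v h)) (at x)" for x
    by (rule has_derivative_eq_rhs[OF has_derivative_add[OF has_derivative_scaleR[OF f(1) G(2)]
            has_derivative_scaleR[OF f(2) G(1)]]])
      (simp add: fun_eq_iff matrix_vector_mult_add_rdistrib outer_mult_vec scaleR_matrix_vector_assoc)
  moreover have "continuous_on UNIV (\<lambda>x. f x *\<^sub>R H' x + f' x *\<^sub>R H x + (outer (G x) (G' x) + outer (G' x) (G x)))"
    using d cont by (intro continuous_intros) auto
  moreover have "transpose (f x *\<^sub>R H' x + f' x *\<^sub>R H x + (outer (G x) (G' x) + outer (G' x) (G x))) =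
      f x *\<^sub>R H' x + f' x *\<^sub>R H x + (outer (G x) (G' x) + outer (G' x) (G x))" for x
    by (simp add: transpose_add transpose_scaleR transpose_outer H add.commute)
  ultimately show ?thesis unfolding C2_data_def by blast
qed

definition C2_smooth :: "(real ^ 'd \<Rightarrow> real) \<Rightarrow> bool" where
  "C2_smooth f \<longleftrightarrow> (\<exists>G H. C2_data f G H)"

lemma C2_smooth_const [simp]: "C2_smooth (\<lambda>x. c)"
  and C2_smooth_component [simp]: "C2_smooth (\<lambda>x. x $ i)"
  unfolding C2_smooth_def using C2_data_const C2_data_component by blast+

lemma C2_smooth_add: "C2_smooth f \<Longrightarrow> C2_smooth g \<Longrightarrow> C2_smooth (\<lambda>x. f x + g x)"
  unfolding C2_smooth_def using C2_data_add by blast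

lemma C2_smooth_mult: "C2_smooth f \<Longrightarrow> C2_smooth g \<Longrightarrow> C2_smooth (\<lambda>x. f x * g x)"
  unfolding C2_smooth_def using C2_data_mult by blast

lemma C2_smooth_diff:
  assumes "C2_smooth f" "C2_smooth g"
  shows "C2_smooth (\<lambda>x. f x - g x)"
  using C2_smooth_add[OF assms(1) C2_smooth_mult[OF C2_smooth_const[of "-1"] assms(2)]] by simp

lemma C2_smooth_sum: "(\<And>a. a \<in> A \<Longrightarrow> C2_smooth (f a)) \<Longrightarrow> C2_smooth (\<lambda>x. \<Sum>a\<in>A. f a x)"
  by (induction A rule: infinite_finite_induct) (auto intro: C2_smooth_add)

lemma C2_smooth_prod: "(\<And>a. a \<in> A \<Longrightarrow> C2_smooth (f a)) \<Longrightarrow> C2_smooth (\<lambda>x. \<Prod>a\<in>A. f a x)"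
  by (induction A rule: infinite_finite_induct) (auto intro: C2_smooth_mult)

lemma gradient_eqI:
  assumes "(f has_derivative (\<lambda>h. g \<bullet> h)) (at x)"
  shows "gradient f x = g"
  unfolding gradient_def frechet_derivative_at[OF assms, symmetric]
  by (simp add: vec_eq_iff inner_axis)

lemma C2_data_gradient:
  assumes "C2_data f G H"
  shows "gradient f = G" "hessian f x = H x"
proof -
  show *: "gradient f = G"
    using assms gradient_eqI by (auto simp: C2_data_def fun_eq_iff)
  have "(G has_derivative (\<lambda>h. H x *v h)) (at x)" using assms by (simp add: C2_data_def)
  from frechet_derivative_at[OF this, symmetric] show "hessian f x = H x"
    unfolding hessian_def * jacobian_def by (simp only: matrix_of_matrix_vector_mul)
qed

section \<open>Smallest eigenvalues and strong convexity\<close>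

lemma symmetric_inner:
  assumes "transpose A = (A :: real ^ 'd ^ 'd)"
  shows "x \<bullet> (A *v y) = y \<bullet> (A *v x)"
  by (metis assms dot_lmul_matrix inner_commute transpose_matrix_vector)

text \<open>\<open>LEAST\<close> over the reals is informative only once a least eigenvalue is
  exhibited. It is the minimum \<mu> of the quadratic form on the unit sphere, attained at v: A -
  \<mu> I is positive semidefinite and its form vanishes at v, which forces v into the
  kernel.\<close>

lemma smallest_eigenvalue_ge:
  fixes A :: "real ^ 'd ^ 'd"
  assumes sym: "transpose A = A" and lower: "\<And>x. norm x = 1 \<Longrightarrow> x \<bullet> (A *v x) \<ge> c"
  shows "smallest_eigenvalue A \<ge> c"
proof -
  have cont: "continuous_on (sphere 0 1) (\<lambda>x. x \<bullet> (A *v x))"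
    by (intro continuous_intros)
  have nonempty: "sphere (0 :: real ^ 'd) 1 \<noteq> {}" by simp
  obtain v where v: "v \<in> sphere 0 1" "\<And>x. x \<in> sphere 0 1 \<Longrightarrow> v \<bullet> (A *v v) \<le> x \<bullet> (A *v x)"
    using continuous_attains_inf[OF compact_sphere nonempty cont] by blast
  define \<mu> where "\<mu> = v \<bullet> (A *v v)"
  have nv: "norm v = 1" using v(1) by simp
  have ray: "x \<bullet> (A *v x) \<ge> \<mu> * (x \<bullet> x)" for x
  proof (cases "x = 0")
    case False
    have "\<mu> \<le> (x /\<^sub>R norm x) \<bullet> (A *v (x /\<^sub>R norm x))"
      unfolding \<mu>_def using False by (intro v(2)) simp
    also have "\<dots> = (x \<bullet> (A *v x)) / (x \<bullet> x)"
      by (simp add: matrix_vector_mult_scaleR field_simps power2_eq_square flip: power2_norm_eq_inner)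
    finally show ?thesis using False by (simp add: field_simps)
  qed simp
  let ?B = "\<lambda>x. A *v x - \<mu> *\<^sub>R x"
  have B0: "v \<bullet> ?B v = 0" using nv by (simp add: \<mu>_def inner_diff_right norm_eq_1)
  have Bpos: "x \<bullet> ?B x \<ge> 0" for x using ray[of x] by (simp add: inner_diff_right)
  have Bsym: "x \<bullet> ?B y = y \<bullet> ?B x" for x y
    unfolding inner_diff_right inner_scaleR_right inner_commute[of x y] symmetric_inner[OF sym, of x y] ..
  have "?B v = 0"
  proof (rule ccontr)
    assume nz: "?B v \<noteq> 0"
    let ?w = "?B v"
    define s where "s = ?w \<bullet> ?w"
    define k where "k = ?w \<bullet> ?B ?w"
    have s: "s > 0" using nz by (simp add: s_def)
    have k: "k \<ge> 0" unfolding k_def by (rule Bpos)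
    have expand: "(v + t *\<^sub>R ?w) \<bullet> ?B (v + t *\<^sub>R ?w) = 2 * t * s + t\<^sup>2 * k" for t
    proof -
      have "?B (x + t *\<^sub>R y) = ?B x + t *\<^sub>R ?B y" for x y
        by (simp add: matrix_vector_right_distrib matrix_vector_mult_scaleR scaleR_add_right scaleR_diff_right mult.commute)
      then have "?B (v + t *\<^sub>R ?w) = ?B v + t *\<^sub>R ?B ?w" .
      moreover have "v \<bullet> ?B ?w = s"
        unfolding s_def by (rule Bsym)
      ultimately show ?thesis using B0
        by (simp only: inner_add_left inner_add_right inner_scaleR_left inner_scaleR_right
            s_def[symmetric] k_def[symmetric]) (simp add: power2_eq_square algebra_simps)
    qed
    \<comment> \<open>At v - r w, with w the image of v, the form takes the value - r^2 (k + 2). The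
      denominator is k + 1 because k may be 0.\<close>
    define r where "r = s / (k + 1)"
    have sr: "s = r * (k + 1)" using k by (simp add: r_def)
    have "r > 0" using s k by (simp add: r_def)
    have "2 * (- r) * s + (- r)\<^sup>2 * k = - (r\<^sup>2 * (k + 2))"
      unfolding sr by (simp add: power2_eq_square algebra_simps)
    also have "\<dots> < 0" using \<open>r > 0\<close> k by simp
    finally show False using Bpos[of "v + (- r) *\<^sub>R ?w"] expand[of "- r"] by linarith
  qed
  then have eig: "v \<noteq> 0 \<and> A *v v = \<mu> *\<^sub>R v" using nv by auto
  have "smallest_eigenvalue A = \<mu>"
    unfolding smallest_eigenvalue_def
  proof (rule Least_equality)
    show "\<exists>v. v \<noteq> 0 \<and> A *v v = \<mu> *\<^sub>R v" using eig by blast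
    fix \<nu> assume "\<exists>v. v \<noteq> 0 \<and> A *v v = \<nu> *\<^sub>R v"
    then obtain y where y: "y \<noteq> 0" "A *v y = \<nu> *\<^sub>R y" by blast
    then show "\<mu> \<le> \<nu>" using ray[of y] by simp
  qed
  then show ?thesis using lower[OF nv] by (simp add: \<mu>_def)
qed

lemma quadratic_form_bound:
  fixes D :: "real ^ 'd ^ 'd"
  assumes "norm v = 1"
  shows "\<bar>v \<bullet> (D *v v)\<bar> \<le> real CARD('d) * norm D"
proof -
  have "\<bar>v \<bullet> (D *v v)\<bar> \<le> (\<Sum>i\<in>UNIV. \<bar>v $ i * (D $ i \<bullet> v)\<bar>)"
    by (simp add: inner_vec_def matrix_vector_mul_component)
  also have "\<dots> \<le> (\<Sum>i\<in>(UNIV :: 'd set). norm D)"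
  proof (rule sum_mono)
    fix i
    have "\<bar>D $ i \<bullet> v\<bar> \<le> norm (D $ i) * norm v" by (rule Cauchy_Schwarz_ineq2)
    also have "\<dots> \<le> norm D" using assms Finite_Cartesian_Product.norm_nth_le[of D i] by simp
    finally have "\<bar>D $ i \<bullet> v\<bar> \<le> norm D" .
    moreover have "\<bar>v $ i\<bar> \<le> 1" using component_le_norm_cart[of v i] assms by simp
    ultimately show "\<bar>v $ i * (D $ i \<bullet> v)\<bar> \<le> norm D"
      unfolding abs_mult using mult_mono[of "\<bar>v $ i\<bar>" 1 "\<bar>D $ i \<bullet> v\<bar>" "norm D"] by simp
  qed
  finally show ?thesis by simp
qed

text \<open>The minimum of the quadratic form on the unit sphere is 2 c. By continuity of the
  Hessian the form on unit vectors drops by at most c near x, and the remaining half is the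
  convexity constant.\<close>

lemma strongly_convex_near_positive_definite:
  fixes f :: "real ^ 'd \<Rightarrow> real"
  assumes "C2_smooth f" and pos: "\<And>h. h \<noteq> 0 \<Longrightarrow> h \<bullet> (hessian f x *v h) > 0"
  shows "positive_definite (hessian f x) \<and>
    (\<exists>S c. open S \<and> x \<in> S \<and> c > 0 \<and> strongly_convex_in c f S)"
proof -
  obtain G H where GH: "C2_data f G H" using assms(1) by (auto simp: C2_smooth_def)
  have G: "gradient f = G" and H: "hessian f y = H y" for y using C2_data_gradient[OF GH] by auto
  have sym: "transpose (H y) = H y" for y using GH by (simp add: C2_data_def)
  have cont: "continuous_on (sphere 0 1) (\<lambda>h. h \<bullet> (H x *v h))" by (intro continuous_intros)
  have nonempty: "sphere (0 :: real ^ 'd) 1 \<noteq> {}" by simp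
  obtain v where v: "v \<in> sphere 0 1" "\<And>h. h \<in> sphere 0 1 \<Longrightarrow> v \<bullet> (H x *v v) \<le> h \<bullet> (H x *v h)"
    using continuous_attains_inf[OF compact_sphere nonempty cont] by blast
  define c where "c = v \<bullet> (H x *v v) / 2"
  have "v \<noteq> 0" using v(1) by auto
  then have c: "c > 0" using pos[of v] by (simp add: c_def H)
  define e where "e = c / real CARD('d)"
  have e: "e > 0" using c by (simp add: e_def)
  define S where "S = H -` ball (H x) e"
  have "open S" unfolding S_def
    using GH by (intro open_vimage) (auto simp: C2_data_def)
  moreover have "x \<in> S" using e by (simp add: S_def)
  moreover have "strongly_convex_in c f S"
    unfolding strongly_convex_in_def twice_differentiable_on_def
  proof (intro conjI ballI)
    fix y assume y: "y \<in> S"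
    show "f differentiable at y" "gradient f differentiable at y"
      using GH unfolding G C2_data_def differentiable_def by blast+
    show "c \<le> smallest_eigenvalue (hessian f y)"
      unfolding H
    proof (rule smallest_eigenvalue_ge[OF sym])
      fix h :: "real ^ 'd" assume h: "norm h = 1"
      have "\<bar>h \<bullet> ((H x - H y) *v h)\<bar> \<le> real CARD('d) * norm (H x - H y)"
        by (rule quadratic_form_bound[OF h])
      also have "\<dots> \<le> real CARD('d) * e"
        using y by (intro mult_left_mono) (auto simp: S_def dist_norm)
      also have "\<dots> = c" by (simp add: e_def)
      finally have "h \<bullet> (H x *v h) - h \<bullet> (H y *v h) \<le> c"
        by (simp add: matrix_vector_mult_diff_rdistrib inner_diff_right)
      moreover have "h \<bullet> (H x *v h) \<ge> 2 * c" using v(2)[of h] h by (simp add: c_def)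
      ultimately show "c \<le> h \<bullet> (H y *v h)" by simp
    qed
  qed
  ultimately have "\<exists>S c. open S \<and> x \<in> S \<and> c > 0 \<and> strongly_convex_in c f S" using c by blast
  moreover have "positive_definite (hessian f x)"
    using sym pos by (simp add: positive_definite_def H)
  ultimately show ?thesis by blast
qed

lemma hessian_least_squares:
  fixes T :: "'i \<Rightarrow> real ^ 'd \<Rightarrow> real"
  assumes "finite I" "\<And>\<iota>. \<iota> \<in> I \<Longrightarrow> C2_smooth (T \<iota>)" "\<And>\<iota>. \<iota> \<in> I \<Longrightarrow> A \<iota> = T \<iota> x"
  defines "f \<equiv> \<lambda>y. \<Sum>\<iota>\<in>I. (A \<iota> - T \<iota> y)\<^sup>2"
  shows "C2_smooth f" "hessian f x *v h = (\<Sum>\<iota>\<in>I. (2 * (gradient (T \<iota>) x \<bullet> h)) *\<^sub>R gradient (T \<iota>) x)"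
proof -
  show C2: "C2_smooth f"
    unfolding f_def power2_eq_square
    using assms(2) by (intro C2_smooth_sum C2_smooth_mult C2_smooth_diff) auto
  have T: "(T \<iota> has_derivative (\<lambda>h. gradient (T \<iota>) y \<bullet> h)) (at y)"
    and T': "\<exists>B. (gradient (T \<iota>) has_derivative (\<lambda>h. B *v h)) (at y)" if "\<iota> \<in> I" for \<iota> y
    using assms(2)[OF that] C2_data_gradient(1) unfolding C2_smooth_def C2_data_def by metis+
  have grad: "gradient f = (\<lambda>y. \<Sum>\<iota>\<in>I. (- 2 * (A \<iota> - T \<iota> y)) *\<^sub>R gradient (T \<iota>) y)"
  proof
    fix y
    have "((\<lambda>y. (A \<iota> - T \<iota> y)\<^sup>2) has_derivative (\<lambda>h. ((- 2 * (A \<iota> - T \<iota> y)) *\<^sub>R gradient (T \<iota>) y) \<bullet> h)) (at y)"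
      if "\<iota> \<in> I" for \<iota>
      unfolding power2_eq_square
      by (rule has_derivative_eq_rhs, (rule derivative_intros T[OF that])+) (simp add: fun_eq_iff algebra_simps)
    then have "(f has_derivative (\<lambda>h. \<Sum>\<iota>\<in>I. ((- 2 * (A \<iota> - T \<iota> y)) *\<^sub>R gradient (T \<iota>) y) \<bullet> h)) (at y)"
      unfolding f_def by (intro has_derivative_sum) auto
    then show "gradient f y = (\<Sum>\<iota>\<in>I. (- 2 * (A \<iota> - T \<iota> y)) *\<^sub>R gradient (T \<iota>) y)"
      by (intro gradient_eqI) (simp add: inner_sum_left)
  qed
  have "(gradient f has_derivative (\<lambda>h. \<Sum>\<iota>\<in>I. (2 * (gradient (T \<iota>) x \<bullet> h)) *\<^sub>R gradient (T \<iota>) x)) (at x)"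
    unfolding grad
  proof (rule has_derivative_sum)
    fix \<iota> assume \<iota>: "\<iota> \<in> I"
    obtain B where B: "(gradient (T \<iota>) has_derivative (\<lambda>h. B *v h)) (at x)" using T'[OF \<iota>] by blast
    \<comment> \<open>The product rule also produces a term with B, the Hessian of
      \<open>T \<iota>\<close>; its factor is the residual, which vanishes at x.\<close>
    show "((\<lambda>y. (- 2 * (A \<iota> - T \<iota> y)) *\<^sub>R gradient (T \<iota>) y) has_derivative
        (\<lambda>h. (2 * (gradient (T \<iota>) x \<bullet> h)) *\<^sub>R gradient (T \<iota>) x)) (at x)"
      by (rule has_derivative_eq_rhs, (rule derivative_intros T[OF \<iota>] B)+)
        (simp add: fun_eq_iff assms(3)[OF \<iota>])
  qed
  moreover have "(gradient f has_derivative (\<lambda>h. hessian f x *v h)) (at x)"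
    using C2 C2_data_gradient unfolding C2_smooth_def C2_data_def by metis
  ultimately have "(\<lambda>h. \<Sum>\<iota>\<in>I. (2 * (gradient (T \<iota>) x \<bullet> h)) *\<^sub>R gradient (T \<iota>) x) = (\<lambda>h. hessian f x *v h)"
    by (rule has_derivative_unique)
  then show "hessian f x *v h = (\<Sum>\<iota>\<in>I. (2 * (gradient (T \<iota>) x \<bullet> h)) *\<^sub>R gradient (T \<iota>) x)"
    by (simp only: fun_eq_iff)
qed

section \<open>The Jacobian of the parametrization\<close>

text \<open>Subtract from the variation of each factor the multiple of that factor which clears row
  \<open>i0 p k\<close>. What is left is a combination of the basis \<open>dirs\<close>, in which
  the rank-one tensor itself has the sum of the multiples as coefficient. So the only kernel is the
  one that comes from rescaling factors.\<close>

lemma tangent_relation_trivial: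
  assumes "finite K" "finite P" "tangent_indep K N P x i0"
    and i0: "\<And>p k. p \<in> P \<Longrightarrow> k \<in> K \<Longrightarrow> i0 p k \<in> {1..N k} \<and> x (p, k, i0 p k) \<noteq> 0"
    and rel: "\<And>\<iota>. \<iota> \<in> multi_indices K N \<Longrightarrow>
      (\<Sum>p\<in>P. \<Sum>k\<in>K. dx p k (\<iota> k) * (\<Prod>k'\<in>K - {k}. x (p, k', \<iota> k'))) = 0"
  shows "\<exists>c. \<forall>p\<in>P. (\<Sum>k\<in>K. c p k) = 0 \<and> (\<forall>k\<in>K. \<forall>i\<in>{1..N k}. dx p k i = c p k * x (p, k, i))"
proof -
  define c where "c p k = dx p k (i0 p k) / x (p, k, i0 p k)" for p k
  define d where "d p k i = dx p k i - c p k * x (p, k, i)" for p k i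
  define w where "w = (\<lambda>(p, \<delta>). case \<delta> of None \<Rightarrow> (\<Sum>k\<in>K. c p k) | Some (k, i) \<Rightarrow> d p k i)"
  have d0: "d p k (i0 p k) = 0" if "p \<in> P" "k \<in> K" for p k
    using i0[OF that] by (simp add: d_def c_def)
  have column: "(\<Sum>\<delta>\<in>dirs K N (i0 p). w (p, \<delta>) * tangent K (\<lambda>k i. x (p, k, i)) \<delta> \<iota>) =
      (\<Sum>k\<in>K. dx p k (\<iota> k) * (\<Prod>k'\<in>K - {k}. x (p, k', \<iota> k')))"
    if p: "p \<in> P" and \<iota>: "\<iota> \<in> multi_indices K N" for p \<iota>
  proof -
    let ?\<Pi> = "\<lambda>k. \<Prod>k'\<in>K - {k}. x (p, k', \<iota> k')"
    let ?X = "\<Prod>k\<in>K. x (p, k, \<iota> k)"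
    have X: "x (p, k, \<iota> k) * ?\<Pi> k = ?X" if "k \<in> K" for k
      using that assms(1) by (simp add: prod.remove)
    have inner: "(\<Sum>i\<in>{1..N k} - {i0 p k}. d p k i * (of_bool (\<iota> k = i) * ?\<Pi> k)) = d p k (\<iota> k) * ?\<Pi> k"
      if k: "k \<in> K" for k
    proof -
      have "\<iota> k \<in> {1..N k}" using \<iota> k by (auto simp: multi_indices_def)
      moreover have "(\<Sum>i\<in>{1..N k} - {i0 p k}. d p k i * (of_bool (\<iota> k = i) * ?\<Pi> k)) =
          (\<Sum>i\<in>{1..N k}. d p k i * (of_bool (\<iota> k = i) * ?\<Pi> k))"
        using d0[OF p k] by (intro sum.mono_neutral_left) auto
      moreover have "\<dots> = (\<Sum>i\<in>{1..N k}. if i = \<iota> k then d p k i * ?\<Pi> k else 0)"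
        by (intro sum.cong) auto
      ultimately show ?thesis by simp
    qed
    have "(\<Sum>\<delta>\<in>dirs K N (i0 p). w (p, \<delta>) * tangent K (\<lambda>k i. x (p, k, i)) \<delta> \<iota>) =
        (\<Sum>k\<in>K. c p k) * ?X +
        (\<Sum>\<delta>\<in>Some ` (SIGMA k:K. {1..N k} - {i0 p k}). w (p, \<delta>) * tangent K (\<lambda>k i. x (p, k, i)) \<delta> \<iota>)"
      unfolding dirs_def using assms(1) by (subst sum.insert) (auto simp: w_def)
    also have "(\<Sum>\<delta>\<in>Some ` (SIGMA k:K. {1..N k} - {i0 p k}). w (p, \<delta>) * tangent K (\<lambda>k i. x (p, k, i)) \<delta> \<iota>) =
        (\<Sum>(k, i)\<in>(SIGMA k:K. {1..N k} - {i0 p k}). d p k i * (of_bool (\<iota> k = i) * ?\<Pi> k))"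
      by (subst sum.reindex) (auto simp: w_def intro!: sum.cong)
    also have "\<dots> = (\<Sum>k\<in>K. \<Sum>i\<in>{1..N k} - {i0 p k}. d p k i * (of_bool (\<iota> k = i) * ?\<Pi> k))"
      using assms(1) by (intro sum.Sigma[symmetric]) auto
    also have "\<dots> = (\<Sum>k\<in>K. d p k (\<iota> k) * ?\<Pi> k)" using inner by (intro sum.cong refl)
    also have "(\<Sum>k\<in>K. c p k) * ?X + (\<Sum>k\<in>K. d p k (\<iota> k) * ?\<Pi> k) =
        (\<Sum>k\<in>K. c p k * ?X + d p k (\<iota> k) * ?\<Pi> k)"
      by (simp add: sum.distrib sum_distrib_right)
    also have "\<dots> = (\<Sum>k\<in>K. dx p k (\<iota> k) * ?\<Pi> k)"
    proof (rule sum.cong[OF refl])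
      fix k assume "k \<in> K"
      from X[OF this] show "c p k * ?X + d p k (\<iota> k) * ?\<Pi> k = dx p k (\<iota> k) * ?\<Pi> k"
        unfolding d_def by (simp add: algebra_simps)
    qed
    finally show ?thesis .
  qed
  have zero: "(\<Sum>j\<in>(SIGMA p:P. dirs K N (i0 p)). w j * (\<lambda>(p, \<delta>). tangent K (\<lambda>k i. x (p, k, i)) \<delta>) j \<iota>) = 0"
    if \<iota>: "\<iota> \<in> multi_indices K N" for \<iota>
  proof -
    have "(\<Sum>j\<in>(SIGMA p:P. dirs K N (i0 p)). w j * (\<lambda>(p, \<delta>). tangent K (\<lambda>k i. x (p, k, i)) \<delta>) j \<iota>) =
        (\<Sum>(p, \<delta>)\<in>(SIGMA p:P. dirs K N (i0 p)). w (p, \<delta>) * tangent K (\<lambda>k i. x (p, k, i)) \<delta> \<iota>)"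
      by (rule sum.cong[OF refl]) (simp only: case_prod_beta prod.collapse)
    also have "\<dots> = (\<Sum>p\<in>P. \<Sum>\<delta>\<in>dirs K N (i0 p). w (p, \<delta>) * tangent K (\<lambda>k i. x (p, k, i)) \<delta> \<iota>)"
      using assms(1,2) by (intro sum.Sigma[symmetric]) auto
    also have "\<dots> = (\<Sum>p\<in>P. \<Sum>k\<in>K. dx p k (\<iota> k) * (\<Prod>k'\<in>K - {k}. x (p, k', \<iota> k')))"
      using column \<iota> by (intro sum.cong refl)
    finally show ?thesis using rel[OF \<iota>] by simp
  qed
  have w0: "w (p, \<delta>) = 0" if "p \<in> P" "\<delta> \<in> dirs K N (i0 p)" for p \<delta>
    using indep_onD[OF assms(3)[unfolded tangent_indep_def] zero, of "(p, \<delta>)"] that by simp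
  have "(\<Sum>k\<in>K. c p k) = 0" if "p \<in> P" for p
    using w0[OF that, of None] by (simp add: w_def)
  moreover have "dx p k i = c p k * x (p, k, i)" if "p \<in> P" "k \<in> K" "i \<in> {1..N k}" for p k i
  proof (cases "i = i0 p k")
    case True
    then show ?thesis using i0[OF that(1,2)] by (simp add: c_def)
  next
    case False
    then show ?thesis using w0[OF that(1), of "Some (k, i)"] that by (simp add: w_def d_def)
  qed
  ultimately show ?thesis by blast
qed

text \<open>Row \<open>i0 p k\<close> must be nonzero for the reduction to the basis
  \<open>dirs\<close>, and row 1 for scaling it to the prescribed entries. Each of these is a
  generic condition, satisfied by the constant 1.\<close>

lemma nondefective_nonzero_entries:
  assumes "finite K" "nondefective K N r" "\<And>k. k \<in> K \<Longrightarrow> N k \<ge> 1"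
  shows "\<exists>x i0. tangent_indep K N {..<r} x i0 \<and> (\<forall>p<r. \<forall>k\<in>K. i0 p k \<in> {1..N k} \<and>
    x (p, k, i0 p k) \<noteq> 0 \<and> x (p, k, 1) \<noteq> 0)"
proof -
  obtain x0 i0 where i0: "\<And>p k. p < r \<Longrightarrow> k \<in> K \<Longrightarrow> i0 p k \<in> {1..N k}"
    and x0: "tangent_indep K N {..<r} x0 i0"
    using assms(2) by (auto simp: nondefective_def)
  define C where "C b x \<longleftrightarrow> (case b of None \<Rightarrow> tangent_indep K N {..<r} x i0 | Some b \<Rightarrow> x b \<noteq> 0)"
    for b and x :: "nat \<times> nat \<times> nat \<Rightarrow> real"
  define Z where "Z = {..<r} \<times> K"
  have "\<exists>x. \<forall>b\<in>insert None (Some ` ((\<lambda>(p, k). (p, k, i0 p k)) ` Z \<union> (\<lambda>(p, k). (p, k, 1)) ` Z)). C b x"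
  proof (rule generic_common_point)
    have "generic (\<lambda>x. tangent_indep K N {..<r} x i0)"
      unfolding tangent_indep_def using assms(1)
      by (intro tangent_generic finite_SigmaI) (auto intro!: polyfun_add polyfun_mult polyfun_diff)
    moreover have "generic (\<lambda>x. x b \<noteq> 0)" for b :: "nat \<times> nat \<times> nat"
      unfolding generic_def
    proof (intro allI impI)
      fix x y :: "nat \<times> nat \<times> nat \<Rightarrow> real" assume "x b \<noteq> 0"
      then show "finite {t. \<not> (1 - t) * x b + t * y b \<noteq> 0}"
        unfolding not_not
        by (intro polyfun_finite_zeros[where ?t0.0 = 0])
          (auto intro!: polyfun_add polyfun_mult polyfun_diff)
    qed
    ultimately show "generic (C b)" for b
      by (cases b) (simp_all add: C_def[abs_def])
    show "\<exists>x. C b x" for b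
      using x0 by (cases b) (auto simp: C_def intro: exI[of _ "\<lambda>_. 1"])
  qed (use assms(1) in \<open>simp add: Z_def\<close>)
  then obtain x where x: "\<And>b. b \<in> insert None (Some ` ((\<lambda>(p, k). (p, k, i0 p k)) ` Z \<union> (\<lambda>(p, k). (p, k, 1)) ` Z)) \<Longrightarrow> C b x"
    by blast
  have "tangent_indep K N {..<r} x i0" using x[of None] by (simp add: C_def)
  moreover have "x (p, k, i0 p k) \<noteq> 0" "x (p, k, 1) \<noteq> 0" if "p < r" "k \<in> K" for p k
  proof -
    have "(p, k) \<in> Z" using that by (simp add: Z_def)
    then show "x (p, k, i0 p k) \<noteq> 0" "x (p, k, 1) \<noteq> 0"
      using x[of "Some (p, k, i0 p k)"] x[of "Some (p, k, 1)"] by (force simp: C_def)+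
  qed
  ultimately show ?thesis using i0 by blast
qed

section \<open>Derivative of the factor parametrization\<close>

lemma C2_smooth_factors: "C2_smooth (\<lambda>\<theta>. factors e u \<theta> k i j)"
  by (cases "k = 1"; cases "i = 1") (simp_all add: factors_def prepend_row_def)

lemma C2_smooth_cp_tensor: "C2_smooth (\<lambda>\<theta>. cp_tensor m r (factors e u \<theta>) \<iota>)"
  unfolding cp_tensor_def by (intro C2_smooth_sum C2_smooth_prod C2_smooth_factors)

text \<open>\<open>factors e u\<close> is affine in the variables. The prescribed rows form its
  constant part, so the derivative has zero rows in their place.\<close>

lemma has_derivative_factors:
  "((\<lambda>\<theta>. factors e u \<theta> k i j) has_derivative (\<lambda>h. factors e (\<lambda>_ _. 0) h k i j)) (at \<theta>)"
  by (cases "k = 1"; cases "i = 1")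
    (simp_all add: factors_def prepend_row_def bounded_linear_imp_has_derivative bounded_linear_vec_nth)

lemma gradient_cp_tensor:
  "gradient (\<lambda>\<theta>. cp_tensor m r (factors e u \<theta>) \<iota>) \<theta> \<bullet> h =
    (\<Sum>j\<in>{1..r}. \<Sum>k\<in>{1..m}. factors e (\<lambda>_ _. 0) h k (\<iota> k) j *
      (\<Prod>k'\<in>{1..m} - {k}. factors e u \<theta> k' (\<iota> k') j))" (is "gradient ?T \<theta> \<bullet> h = ?D h")
proof -
  have "(?T has_derivative ?D) (at \<theta>)"
    unfolding cp_tensor_def
    by (intro has_derivative_sum has_derivative_prod has_derivative_factors)
  moreover have "(?T has_derivative (\<lambda>h. gradient ?T \<theta> \<bullet> h)) (at \<theta>)"
    using C2_smooth_cp_tensor[of m r e u \<iota>] C2_data_gradient(1) unfolding C2_smooth_def C2_data_def by metis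
  ultimately have "?D = (\<lambda>h. gradient ?T \<theta> \<bullet> h)" by (rule has_derivative_unique)
  then show ?thesis by (simp only: fun_eq_iff)
qed

definition jacobian_injective ::
  "nat \<Rightarrow> (nat \<Rightarrow> nat) \<Rightarrow> nat \<Rightarrow> (nat \<times> nat \<times> nat \<Rightarrow> 'd) \<Rightarrow> (nat \<Rightarrow> nat \<Rightarrow> real) \<Rightarrow> real ^ 'd \<Rightarrow> bool" where
  "jacobian_injective m N r e u \<theta> \<longleftrightarrow> (\<forall>h. (\<forall>\<iota>\<in>multi_indices {1..m} N.
     gradient (\<lambda>\<theta>. cp_tensor m r (factors e u \<theta>) \<iota>) \<theta> \<bullet> h = 0) \<longrightarrow> h = 0)"

lemma ex_jacobian_injective:
  fixes e :: "nat \<times> nat \<times> nat \<Rightarrow> 'd::finite"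
  assumes "m \<ge> 1" "\<And>i. i \<in> {1..m} \<Longrightarrow> N i \<ge> 1" "nondefective {1..m} N r"
    and u: "\<And>i j. i \<in> {2..m} \<Longrightarrow> j \<in> {1..r} \<Longrightarrow> u i j \<noteq> 0"
    and e: "bij_betw e (param_index m N r) UNIV"
  shows "\<exists>\<theta>. jacobian_injective m N r e u \<theta>"
proof -
  let ?K = "{1..m}"
  obtain x i0 where x: "tangent_indep ?K N {..<r} x i0"
    "\<And>p k. p < r \<Longrightarrow> k \<in> ?K \<Longrightarrow> i0 p k \<in> {1..N k} \<and> x (p, k, i0 p k) \<noteq> 0 \<and> x (p, k, 1) \<noteq> 0"
    using nondefective_nonzero_entries[OF _ assms(3)] assms(2) by fastforce
  \<comment> \<open>Rescaling factors by nonzero scalars does not change tangent spaces. Here row 1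
    is brought to the prescribed entries in every mode but the first, and s is nonzero because
    \<open>u\<close> is. Points count from 0 and columns from 1, hence \<open>j - 1\<close>.\<close>
  define s where "s k j = (if k = 1 then 1 else u k j / x (j - 1, k, 1))" for k j :: nat
  have s0: "s k j \<noteq> 0" if "k \<in> ?K" "j \<in> {1..r}" for k j
  proof -
    have "j - 1 < r" using that by auto
    then show ?thesis using that u[of k j] x(2)[of "j - 1" k] by (auto simp: s_def)
  qed
  define \<theta> :: "real ^ 'd" where "\<theta> = (\<chi> d. case inv_into (param_index m N r) e d of
    (k, a, j) \<Rightarrow> s k j * x (j - 1, k, if k = 1 then a else a + 1))"
  have \<theta>e: "\<theta> $ e (k, a, j) = s k j * x (j - 1, k, if k = 1 then a else a + 1)"
    if "(k, a, j) \<in> param_index m N r" for k a j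
    using e that by (simp add: \<theta>_def bij_betw_def)
  have fac: "factors e u \<theta> k i j = s k j * x (j - 1, k, i)"
    if "k \<in> ?K" "i \<in> {1..N k}" "j \<in> {1..r}" for k i j
  proof (cases "k = 1")
    case True
    then have "(k, i, j) \<in> param_index m N r" using that by (simp add: param_index_def)
    from \<theta>e[OF this] True show ?thesis by (simp add: factors_def)
  next
    case False
    show ?thesis
    proof (cases "i = 1")
      case True
      moreover have "j - 1 < r" using that by auto
      ultimately show ?thesis using False x(2)[of "j - 1" k] that
        by (simp add: factors_def prepend_row_def s_def)
    next
      case i: False
      then have "(k, i - 1, j) \<in> param_index m N r" using that False by (auto simp: param_index_def)
      from \<theta>e[OF this] False i that show ?thesis by (simp add: factors_def prepend_row_def)
    qed
  qed
  have "h = 0"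
    if h: "\<And>\<iota>. \<iota> \<in> multi_indices ?K N \<Longrightarrow> gradient (\<lambda>\<theta>. cp_tensor m r (factors e u \<theta>) \<iota>) \<theta> \<bullet> h = 0"
    for h :: "real ^ 'd"
  proof -
    let ?h = "factors e (\<lambda>_ _. 0) h"
    \<comment> \<open>The factors at \<theta> are those of x times s; moving the scalars of the
      other modes into the variation gives a relation at x itself.\<close>
    define dx where "dx p k i = ?h k i (p + 1) * (\<Prod>k'\<in>?K - {k}. s k' (p + 1))" for p k i
    have "(\<Sum>p\<in>{..<r}. \<Sum>k\<in>?K. dx p k (\<iota> k) * (\<Prod>k'\<in>?K - {k}. x (p, k', \<iota> k'))) = 0"
      if \<iota>: "\<iota> \<in> multi_indices ?K N" for \<iota>
    proof -
      have \<iota>N: "\<iota> k \<in> {1..N k}" if "k \<in> ?K" for k using \<iota> that by (auto simp: multi_indices_def)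
      have "(\<Sum>p\<in>{..<r}. \<Sum>k\<in>?K. dx p k (\<iota> k) * (\<Prod>k'\<in>?K - {k}. x (p, k', \<iota> k'))) =
        (\<Sum>p\<in>{..<r}. \<Sum>k\<in>?K. ?h k (\<iota> k) (p + 1) * (\<Prod>k'\<in>?K - {k}. factors e u \<theta> k' (\<iota> k') (p + 1)))"
      proof (intro sum.cong refl)
        fix p k assume p: "p \<in> {..<r}" and k: "k \<in> ?K"
        have "(\<Prod>k'\<in>?K - {k}. factors e u \<theta> k' (\<iota> k') (p + 1)) =
            (\<Prod>k'\<in>?K - {k}. s k' (p + 1) * x (p, k', \<iota> k'))"
        proof (rule prod.cong[OF refl])
          fix k' assume "k' \<in> ?K - {k}"
          then have k': "k' \<in> ?K" by blast
          show "factors e u \<theta> k' (\<iota> k') (p + 1) = s k' (p + 1) * x (p, k', \<iota> k')"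
            using fac[OF k' \<iota>N[OF k'], of "p + 1"] p by simp
        qed
        then show "dx p k (\<iota> k) * (\<Prod>k'\<in>?K - {k}. x (p, k', \<iota> k')) =
            ?h k (\<iota> k) (p + 1) * (\<Prod>k'\<in>?K - {k}. factors e u \<theta> k' (\<iota> k') (p + 1))"
          by (simp add: dx_def prod.distrib)
      qed
      also have "\<dots> = (\<Sum>j\<in>{1..r}. \<Sum>k\<in>?K. ?h k (\<iota> k) j * (\<Prod>k'\<in>?K - {k}. factors e u \<theta> k' (\<iota> k') j))"
        by (rule sum.reindex_bij_witness[of _ "\<lambda>j. j - 1" "\<lambda>p. p + 1"]) auto
      also have "\<dots> = 0" using h[OF \<iota>] unfolding gradient_cp_tensor .
      finally show ?thesis .
    qed
    from tangent_relation_trivial[OF _ _ x(1) _ this] x(2)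
    obtain c where c': "\<forall>p\<in>{..<r}. (\<Sum>k\<in>?K. c p k) = 0 \<and>
      (\<forall>k\<in>?K. \<forall>i\<in>{1..N k}. dx p k i = c p k * x (p, k, i))"
      by blast
    have c: "(\<Sum>k\<in>?K. c p k) = 0"
      "k \<in> ?K \<Longrightarrow> i \<in> {1..N k} \<Longrightarrow> dx p k i = c p k * x (p, k, i)" if "p < r" for p k i
      using c' that by blast+
    have c0: "c p k = 0" if p: "p < r" and k: "k \<in> ?K" for p k
    proof -
      \<comment> \<open>In the modes other than the first, row 1 is nonzero but does not vary, which
        excludes a rescaling. The first mode follows because the multiples add up to 0.\<close>
      have rest: "c p k = 0" if "k \<in> ?K" "k \<noteq> 1" for k
      proof -
        have "dx p k 1 = 0" using that by (simp add: dx_def factors_def prepend_row_def)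
        then show ?thesis using c(2)[OF p that(1), of 1] x(2)[OF p that(1)] assms(2)[OF that(1)] by simp
      qed
      have "(\<Sum>k\<in>?K. c p k) = c p 1 + (\<Sum>k\<in>?K - {1}. c p k)"
        using assms(1) by (intro sum.remove) auto
      also have "(\<Sum>k\<in>?K - {1}. c p k) = 0" using rest by (intro sum.neutral) auto
      finally have "c p 1 = 0" using c(1)[OF p] by simp
      then show ?thesis using rest k by (cases "k = 1") auto
    qed
    have hz: "?h k i j = 0" if "k \<in> ?K" "i \<in> {1..N k}" "j \<in> {1..r}" for k i j
    proof -
      have "j - 1 < r" using that by auto
      then have "dx (j - 1) k i = 0" using c(2)[of "j - 1" k i] c0[of "j - 1" k] that by simp
      moreover have "(\<Prod>k'\<in>?K - {k}. s k' j) \<noteq> 0"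
        unfolding prod_zero_iff[OF finite_Diff[OF finite_atLeastAtMost]] using s0 that(3) by auto
      ultimately show ?thesis using that(3) by (simp add: dx_def)
    qed
    have "h $ d = 0" for d
    proof -
      obtain k a j where kaj: "d = e (k, a, j)" "(k, a, j) \<in> param_index m N r"
        using e by (metis UNIV_I bij_betw_imp_surj_on imageE prod_cases3)
      have "k \<in> ?K" "j \<in> {1..r}" "a \<in> {1..(if k = 1 then N k else N k - 1)}"
        using kaj(2) by (auto simp: param_index_def split: if_splits)
      then show ?thesis
        using hz[of k "if k = 1 then a else a + 1" j] kaj(1)
        by (auto simp: factors_def prepend_row_def split: if_splits)
    qed
    then show "h = 0" by (simp add: vec_eq_iff)
  qed
  then show ?thesis unfolding jacobian_injective_def by blast
qed

section \<open>Genericity of an injective Jacobian\<close>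

lemma continuous_on_det [continuous_intros]:
  fixes A :: "'a::topological_space \<Rightarrow> real ^ 'd ^ 'd"
  assumes "continuous_on S A"
  shows "continuous_on S (\<lambda>x. det (A x))"
  unfolding det_def by (intro continuous_intros assms)

text \<open>The quadratic form of the Gram matrix at h is the sum of the squares of the
  \<open>g \<iota> \<bullet> h\<close>, so its kernel is the common kernel of these functionals. The
  determinant is wanted because it is continuous in the parameters: it makes the bad set
  closed.\<close>

lemma gram_det_nonzero_iff:
  fixes g :: "'i \<Rightarrow> real ^ 'd"
  assumes "finite I"
  shows "det (\<Sum>\<iota>\<in>I. outer (g \<iota>) (g \<iota>)) \<noteq> 0 \<longleftrightarrow> (\<forall>h. (\<forall>\<iota>\<in>I. g \<iota> \<bullet> h = 0) \<longrightarrow> h = 0)"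
proof -
  let ?G = "\<Sum>\<iota>\<in>I. outer (g \<iota>) (g \<iota>)"
  have G: "?G *v h = (\<Sum>\<iota>\<in>I. (g \<iota> \<bullet> h) *\<^sub>R g \<iota>)" for h
    using assms by (induction I rule: finite_induct)
      (simp_all add: matrix_vector_mult_add_rdistrib outer_mult_vec)
  have "?G *v h = 0 \<longleftrightarrow> (\<forall>\<iota>\<in>I. g \<iota> \<bullet> h = 0)" for h
  proof
    assume "?G *v h = 0"
    then have "h \<bullet> (\<Sum>\<iota>\<in>I. (g \<iota> \<bullet> h) *\<^sub>R g \<iota>) = 0" unfolding G by simp
    then have "(\<Sum>\<iota>\<in>I. (g \<iota> \<bullet> h)\<^sup>2) = 0"
      by (simp add: inner_sum_right power2_eq_square inner_commute)
    then show "\<forall>\<iota>\<in>I. g \<iota> \<bullet> h = 0" using assms by (simp add: sum_nonneg_eq_0_iff)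
  next
    assume "\<forall>\<iota>\<in>I. g \<iota> \<bullet> h = 0"
    then show "?G *v h = 0" unfolding G by (intro sum.neutral) auto
  qed
  moreover have "det ?G \<noteq> 0 \<longleftrightarrow> (\<forall>h. ?G *v h = 0 \<longrightarrow> h = 0)"
    unfolding invertible_det_nz[symmetric] invertible_left_inverse matrix_left_invertible_ker ..
  ultimately show ?thesis by simp
qed

lemma jacobian_injective_generic:
  fixes e :: "nat \<times> nat \<times> nat \<Rightarrow> 'd::finite"
  assumes "jacobian_injective m N r e u \<theta>\<^sub>0"
  shows "{\<theta>. \<not> jacobian_injective m N r e u \<theta>} \<in> null_sets lebesgue"
proof (rule closed_ray_finite_null)
  let ?I = "multi_indices {1..m} N"
  let ?g = "\<lambda>\<iota>. gradient (\<lambda>\<theta>. cp_tensor m r (factors e u \<theta>) \<iota>)"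
  have finI: "finite ?I" by simp
  have cont: "continuous_on UNIV (?g \<iota>)" for \<iota>
  proof -
    obtain G H where GH: "C2_data (\<lambda>\<theta>. cp_tensor m r (factors e u \<theta>) \<iota>) G H"
      using C2_smooth_cp_tensor[of m r e u \<iota>] by (auto simp: C2_smooth_def)
    then have "\<And>x. (G has_derivative (\<lambda>h. H x *v h)) (at x)" by (simp add: C2_data_def)
    then show ?thesis unfolding C2_data_gradient(1)[OF GH] by (intro has_derivative_continuous_on) auto
  qed
  have "{\<theta>. \<not> jacobian_injective m N r e u \<theta>} =
      (\<lambda>\<theta>. det (\<Sum>\<iota>\<in>?I. outer (?g \<iota> \<theta>) (?g \<iota> \<theta>))) -` {0}"
    using gram_det_nonzero_iff[OF finI, of "\<lambda>\<iota>. ?g \<iota> \<theta>" for \<theta>]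
    unfolding jacobian_injective_def by auto
  moreover have "continuous_on UNIV (\<lambda>\<theta>. det (\<Sum>\<iota>\<in>?I. outer (?g \<iota> \<theta>) (?g \<iota> \<theta>)))"
    by (intro continuous_intros cont)
  ultimately show "closed {\<theta>. \<not> jacobian_injective m N r e u \<theta>}"
    by (simp add: closed_vimage)
  fix \<theta> :: "real ^ 'd"
  let ?l = "\<lambda>t. \<theta>\<^sub>0 + t *\<^sub>R (\<theta> - \<theta>\<^sub>0)"
  \<comment> \<open>Along the ray the columns of the Jacobian form a family with entries polynomial
    in t, and t = 0 is the good point \<open>\<theta>\<^sub>0\<close>.\<close>
  define v where "v t p \<iota> = ?g \<iota> (?l t) \<bullet> axis p 1" for t p \<iota>
  have iff: "jacobian_injective m N r e u (?l t) \<longleftrightarrow> indep_on ?I UNIV (v t)" for t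
  proof -
    have sum: "(\<Sum>p\<in>UNIV. h $ p * v t p \<iota>) = ?g \<iota> (?l t) \<bullet> h" for \<iota> h
      unfolding v_def inner_axis by (simp add: inner_vec_def mult.commute)
    show ?thesis
    proof
      assume *: "jacobian_injective m N r e u (?l t)"
      show "indep_on ?I UNIV (v t)"
      proof (rule indep_onI)
        fix c p assume "\<And>\<iota>. \<iota> \<in> ?I \<Longrightarrow> (\<Sum>p\<in>UNIV. c p * v t p \<iota>) = 0"
        then have "(\<chi> p. c p) = 0" using * sum[of "\<chi> p. c p"] unfolding jacobian_injective_def by simp
        then show "c p = 0" by (simp add: vec_eq_iff)
      qed
    next
      assume *: "indep_on ?I UNIV (v t)"
      show "jacobian_injective m N r e u (?l t)"
        unfolding jacobian_injective_def vec_eq_iff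
        using indep_onD[OF *, of "($) h" for h] sum by simp
    qed
  qed
  have "polyfun (\<lambda>t. factors e u (?l t) k i j)" for k i j
    by (cases "k = 1"; cases "i = 1")
      (auto simp: factors_def prepend_row_def intro!: polyfun_add polyfun_mult)
  then have "polyfun (\<lambda>t. v t p \<iota>)" for p \<iota>
    unfolding v_def gradient_cp_tensor
    by (intro polyfun_sum polyfun_mult polyfun_prod polyfun_const)
  then have "finite {t. \<not> indep_on ?I UNIV (v t)}"
    using assms iff[of 0] by (intro indep_on_generic[where ?t0.0 = 0]) auto
  then show "finite {t. ?l t \<in> {\<theta>. \<not> jacobian_injective m N r e u \<theta>}}"
    by (simp add: iff)
qed

theorem corollary4p2:
  fixes m r :: nat
    and N :: "nat \<Rightarrow> nat"
    and u :: "nat \<Rightarrow> nat \<Rightarrow> real"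
    and e :: "nat \<times> nat \<times> nat \<Rightarrow> 'd::finite"
  assumes "m \<ge> 3"
    and "\<And>i. i \<in> {1..m} \<Longrightarrow> N i \<ge> 1"
    and "\<And>i j. 1 \<le> i \<Longrightarrow> i \<le> j \<Longrightarrow> j \<le> m \<Longrightarrow> N i \<ge> N j"
    and "r \<le> rank_bound m N m"
    and "\<And>i j. i \<in> {2..m} \<Longrightarrow> j \<in> {1..r} \<Longrightarrow> u i j \<noteq> 0"
    and "bij_betw e (param_index m N r) UNIV"
  shows "AE \<theta>s in lebesgue.
    (let A = cp_tensor m r (factors e u \<theta>s);
         f = cost m N r e u A
     in positive_definite (hessian f \<theta>s) \<and>
        (\<exists>S c. open S \<and> \<theta>s \<in> S \<and> c > 0 \<and> strongly_convex_in c f S))"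
proof -
  have "nondefective {m - m + 1..m} N (rank_bound m N m)"
    by (rule nondefective_rank_bound) (use assms(1,2) in auto)
  then have "nondefective {1..m} N (rank_bound m N m)" by simp
  then have "nondefective {1..m} N r"
    by (rule nondefective_mono) (use assms(4) in simp_all)
  then have "\<exists>\<theta>. jacobian_injective m N r e u \<theta>"
    using ex_jacobian_injective[OF _ assms(2) _ assms(5,6)] assms(1) by simp
  then obtain \<theta>\<^sub>0 where "jacobian_injective m N r e u \<theta>\<^sub>0" by blast
  then have "AE \<theta> in lebesgue. jacobian_injective m N r e u \<theta>"
    by (intro AE_I'[OF jacobian_injective_generic]) auto
  then show ?thesis
  proof (rule AE_mp, intro AE_I2 impI)
    fix \<theta> assume inj: "jacobian_injective m N r e u \<theta>"
    let ?I = "multi_indices {1..m} N"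
    let ?T = "\<lambda>\<iota> \<theta>. cp_tensor m r (factors e u \<theta>) \<iota>"
    let ?A = "cp_tensor m r (factors e u \<theta>)"
    let ?f = "\<lambda>\<eta>. \<Sum>\<iota>\<in>?I. (?A \<iota> - ?T \<iota> \<eta>)\<^sup>2"
    have f: "cost m N r e u ?A = ?f"
      by (simp add: cost_def frobenius_norm_def multi_indices_def sum_nonneg fun_eq_iff)
    note ls = hessian_least_squares[of ?I ?T ?A \<theta>]
    have C2: "C2_smooth ?f" by (rule ls) (auto intro: C2_smooth_cp_tensor)
    have "h \<bullet> (hessian ?f \<theta> *v h) > 0" if h: "h \<noteq> 0" for h
    proof -
      have "hessian ?f \<theta> *v h = (\<Sum>\<iota>\<in>?I. (2 * (gradient (?T \<iota>) \<theta> \<bullet> h)) *\<^sub>R gradient (?T \<iota>) \<theta>)"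
        by (rule ls) (auto intro: C2_smooth_cp_tensor)
      then have eq: "h \<bullet> (hessian ?f \<theta> *v h) = (\<Sum>\<iota>\<in>?I. 2 * (gradient (?T \<iota>) \<theta> \<bullet> h)\<^sup>2)"
        by (simp add: inner_sum_right power2_eq_square inner_commute mult.assoc)
      obtain \<iota> where "\<iota> \<in> ?I" "gradient (?T \<iota>) \<theta> \<bullet> h \<noteq> 0"
        using inj h unfolding jacobian_injective_def by blast
      then show ?thesis unfolding eq by (intro sum_pos2[of _ \<iota>]) auto
    qed
    from strongly_convex_near_positive_definite[OF C2 this]
    show "let A = cp_tensor m r (factors e u \<theta>); f = cost m N r e u A
     in positive_definite (hessian f \<theta>) \<and>
        (\<exists>S c. open S \<and> \<theta> \<in> S \<and> c > 0 \<and> strongly_convex_in c f S)"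
      unfolding Let_def f by blast
  qed
qed

end
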